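(* $$\Lambda_{4,fd}=\Lambda_{4,bd}=\left\{2\pm\tfrac{2}{k},\ 2\ \middle|\ k\in\mathbb N\right\}.$$
   Context: $\mathbb N=\{1,2,3,\dots\}$. For $n\in\mathbb N$, $\lambda\in\mathbb C$, $\mathcal Q_{n,\lambda}=\mathbb C\langle q_1,\dots,q_n,e\mid\sum_{k=1}^nq_k=\lambda e,\ q_k^2=q_k,\ k=1,\dots,n\rangle$ is the unital complex algebra generated by $n$ idempotents whose sum is $\lambda e$. $\Lambda_{n,fd}$ is the set of all $\lambda\in\mathbb C$ for which there exists a (unital, nonzero) finite-dimensional representation of $\mathcal Q_{n,\lambda}$. $\Lambda_{n,bd}$ is the set of all $\lambda\in\mathbb C$ for which there exist a nonzero complex separable Hilbert space $H$ and bounded operators $Q_1,\dots,Q_n\in B(H)$ with $Q_k^2=Q_k$ ($k=1,\dots,n$) and $\sum_{k=1}^nQ_k=\lambda I$ (the idempotents need not be selfadjoint). *)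

theory Defs
  imports
    "HOL-Analysis.Analysis"
    "HOL-Library.Poly_Mapping"
    "HOL-Algebra.QuotRing"
    "Jordan_Normal_Form.VS_Connect"
begin

section \<open>The algebra generated by idempotents with a prescribed sum\<close>

datatype free_word = Word (letters: "nat list")

instantiation free_word :: monoid_add
begin

definition "0 = Word []"

definition "u + v = Word (letters u @ letters v)"

instance
  by standard (simp_all add: zero_free_word_def plus_free_word_def)

end

text \<open>The convolution product of \<^typ>\<open>free_word \<Rightarrow>\<^sub>0 complex\<close> extends concatenation of words bilinearly,
  so this type is the free unital algebra over the complex numbers on generators indexed by
  \<^typ>\<open>nat\<close>; the word of length one is the generator, the empty word is the unit.\<close>

type_synonym nc_poly = "free_word \<Rightarrow>\<^sub>0 complex"

definition gen :: "nat \<Rightarrow> nc_poly" where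
  "gen k = Poly_Mapping.single (Word [k]) 1"

definition const :: "complex \<Rightarrow> nc_poly" where
  "const c = Poly_Mapping.single 0 c"

definition free_algebra :: "nat \<Rightarrow> (complex, nc_poly) module" where
  "free_algebra n =
    \<lparr>carrier = {p. \<forall>w \<in> Poly_Mapping.keys p. set (letters w) \<subseteq> {1..n}},
     mult = (*), one = 1, zero = 0, add = (+), smult = (\<lambda>c p. const c * p)\<rparr>"

definition relators :: "nat \<Rightarrow> complex \<Rightarrow> nc_poly set" where
  "relators n lam = insert ((\<Sum>k = 1..n. gen k) - const lam) {gen k ^ 2 - gen k | k. k \<in> {1..n}}"

lemma free_algebra_ring: "ring (free_algebra n)"
proof (intro ringI abelian_groupI monoidI)
  fix x y assume "x \<in> carrier (free_algebra n)" "y \<in> carrier (free_algebra n)"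
  thus "x \<oplus>\<^bsub>free_algebra n\<^esub> y \<in> carrier (free_algebra n)"
    using Poly_Mapping.keys_add[of x y] by (auto simp: free_algebra_def)
next
  fix x y assume "x \<in> carrier (free_algebra n)" "y \<in> carrier (free_algebra n)"
  thus "x \<otimes>\<^bsub>free_algebra n\<^esub> y \<in> carrier (free_algebra n)"
    using Poly_Mapping.keys_mult[of x y] by (fastforce simp: free_algebra_def plus_free_word_def)
next
  fix x assume "x \<in> carrier (free_algebra n)"
  thus "\<exists>y\<in>carrier (free_algebra n). y \<oplus>\<^bsub>free_algebra n\<^esub> x = \<zero>\<^bsub>free_algebra n\<^esub>"
    by (intro bexI[of _ "- x"]) (auto simp: free_algebra_def)
qed (auto simp: free_algebra_def zero_free_word_def algebra_simps)

lemma relators_subset: "relators n lam \<subseteq> carrier (free_algebra n)"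
proof -
  interpret ring "free_algebra n" by (rule free_algebra_ring)
  have gen: "gen k \<in> carrier (free_algebra n)" if "k \<in> {1..n}" for k
    using that by (auto simp: gen_def free_algebra_def)
  have const: "const c \<in> carrier (free_algebra n)" for c
    by (auto simp: const_def free_algebra_def zero_free_word_def)
  have minus: "p - q \<in> carrier (free_algebra n)"
    if "p \<in> carrier (free_algebra n)" "q \<in> carrier (free_algebra n)" for p q
    using that Poly_Mapping.keys_diff[of p q] by (auto simp: free_algebra_def)
  have mult: "p * q \<in> carrier (free_algebra n)"
    if "p \<in> carrier (free_algebra n)" "q \<in> carrier (free_algebra n)" for p q
    using m_closed[OF that] by (simp add: free_algebra_def)
  have add: "p + q \<in> carrier (free_algebra n)"
    if "p \<in> carrier (free_algebra n)" "q \<in> carrier (free_algebra n)" for p q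
    using a_closed[OF that] by (simp add: free_algebra_def)
  have sum: "sum gen K \<in> carrier (free_algebra n)" if "K \<subseteq> {1..n}" for K
    using finite_subset[OF that finite_atLeastAtMost] that
  proof (induction K rule: finite_induct)
    case empty
    show ?case by (simp add: free_algebra_def)
  next
    case (insert k K)
    thus ?case by (auto simp del: One_nat_def intro!: add gen)
  qed
  thus ?thesis
    by (auto simp: relators_def power2_eq_square intro!: minus mult gen const sum)
qed

text \<open>\<^const>\<open>FactRing\<close> carries no scalar multiplication; here \<open>c\<close> acts on the quotient as
  multiplication by the coset of \<open>c e\<close>.\<close>

definition quotient_algebra ::
  "(complex, 'a) module \<Rightarrow> 'a set \<Rightarrow> (complex, 'a set) module" where
  "quotient_algebra A I =
    \<lparr>carrier = carrier (A Quot I), mult = mult (A Quot I), one = one (A Quot I),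
     zero = zero (A Quot I), add = add (A Quot I),
     smult = (\<lambda>c X. (I +>\<^bsub>A\<^esub> (c \<odot>\<^bsub>A\<^esub> \<one>\<^bsub>A\<^esub>)) \<otimes>\<^bsub>A Quot I\<^esub> X)\<rparr>"

definition Q_algebra :: "nat \<Rightarrow> complex \<Rightarrow> (complex, nc_poly set) module" where
  "Q_algebra n lam =
    quotient_algebra (free_algebra n) (Idl\<^bsub>free_algebra n\<^esub> (relators n lam))"

section \<open>Finite-dimensional representations\<close>

definition endomorphisms :: "(complex, 'v) module \<Rightarrow> ('v \<Rightarrow> 'v) set" where
  "endomorphisms V = module_hom class_ring V V"

text \<open>Unital algebra homomorphisms from \<open>A\<close> into the linear operators on \<open>V\<close>. Operators are
  functions on the whole type, so equality of operators is equality on \<^term>\<open>carrier V\<close>.\<close>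

definition representation ::
  "(complex, 'a) module \<Rightarrow> (complex, 'v) module \<Rightarrow> ('a \<Rightarrow> 'v \<Rightarrow> 'v) \<Rightarrow> bool" where
  "representation A V \<pi> \<longleftrightarrow>
    (\<forall>a \<in> carrier A. \<pi> a \<in> endomorphisms V) \<and>
    (\<forall>v \<in> carrier V. \<pi> \<one>\<^bsub>A\<^esub> v = v) \<and>
    (\<forall>a \<in> carrier A. \<forall>b \<in> carrier A. \<forall>v \<in> carrier V.
       \<pi> (a \<oplus>\<^bsub>A\<^esub> b) v = \<pi> a v \<oplus>\<^bsub>V\<^esub> \<pi> b v \<and> \<pi> (a \<otimes>\<^bsub>A\<^esub> b) v = \<pi> a (\<pi> b v)) \<and>
    (\<forall>c. \<forall>a \<in> carrier A. \<forall>v \<in> carrier V. \<pi> (c \<odot>\<^bsub>A\<^esub> a) v = c \<odot>\<^bsub>V\<^esub> \<pi> a v)"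

definition Lambda_fd_on :: "'v itself \<Rightarrow> nat \<Rightarrow> complex set" where
  "Lambda_fd_on _ n =
    {lam. \<exists>(V :: (complex, 'v) module) \<pi>.
       vectorspace class_ring V \<and> vectorspace.fin_dim class_ring V \<and> carrier V \<noteq> {\<zero>\<^bsub>V\<^esub>} \<and>
       representation (Q_algebra n lam) V \<pi>}"

section \<open>Idempotents on a separable Hilbert space\<close>

locale complex_inner_product_space = vectorspace "class_ring :: complex ring" V
  for V :: "(complex, 'v) module" (structure) +
  fixes ip :: "'v \<Rightarrow> 'v \<Rightarrow> complex"
  assumes ip_add_left: "\<lbrakk>x \<in> carrier V; y \<in> carrier V; z \<in> carrier V\<rbrakk> \<Longrightarrow>
      ip (x \<oplus> y) z = ip x z + ip y z"
    and ip_smult_left: "\<lbrakk>x \<in> carrier V; y \<in> carrier V\<rbrakk> \<Longrightarrow> ip (c \<odot>\<^bsub>V\<^esub> x) y = c * ip x y"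
    and ip_cnj: "\<lbrakk>x \<in> carrier V; y \<in> carrier V\<rbrakk> \<Longrightarrow> ip y x = cnj (ip x y)"
    and ip_pos: "\<lbrakk>x \<in> carrier V; x \<noteq> \<zero>\<^bsub>V\<^esub>\<rbrakk> \<Longrightarrow> 0 < Re (ip x x)"
begin

definition nrm :: "'v \<Rightarrow> real" where
  "nrm x = sqrt (Re (ip x x))"

text \<open>The locale \<^locale>\<open>Metric_space\<close> demands symmetry and nonnegativity off the carrier as
  well, hence the default value.\<close>

definition dst :: "'v \<Rightarrow> 'v \<Rightarrow> real" where
  "dst x y = (if x \<in> carrier V \<and> y \<in> carrier V then nrm (x \<ominus> y) else 0)"


lemma ip_zero [simp]:
  assumes "x \<in> carrier V"
  shows "ip \<zero> x = 0" "ip x \<zero> = 0"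
proof -
  have "ip (\<zero> \<oplus> \<zero>) x = ip \<zero> x + ip \<zero> x"
    using assms by (intro ip_add_left) auto
  thus "ip \<zero> x = 0" by simp
  thus "ip x \<zero> = 0"
    using ip_cnj[of "\<zero>" x] assms by simp
qed

lemma ip_self_nonneg: "x \<in> carrier V \<Longrightarrow> 0 \<le> Re (ip x x)"
  using ip_pos[of x] by (cases "x = \<zero>") auto

lemma ip_self_eq_0: "x \<in> carrier V \<Longrightarrow> Re (ip x x) = 0 \<longleftrightarrow> x = \<zero>"
  using ip_pos[of x] by (cases "x = \<zero>") auto

lemma ip_add_right:
  assumes "x \<in> carrier V" "y \<in> carrier V" "z \<in> carrier V"
  shows "ip x (y \<oplus> z) = ip x y + ip x z"
  using assms ip_cnj[of "y \<oplus> z" x] ip_cnj[of y x] ip_cnj[of z x] ip_add_left[of y z x] by simp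

lemma ip_smult_right:
  assumes "x \<in> carrier V" "y \<in> carrier V"
  shows "ip x (c \<odot>\<^bsub>V\<^esub> y) = cnj c * ip x y"
  using assms ip_cnj[of "c \<odot>\<^bsub>V\<^esub> y" x] ip_cnj[of y x] ip_smult_left[of y x c] by simp

lemma Re_ip_commute: "\<lbrakk>x \<in> carrier V; y \<in> carrier V\<rbrakk> \<Longrightarrow> Re (ip y x) = Re (ip x y)"
  by (simp add: ip_cnj[of x y])

lemma Re_ip_le:
  assumes x: "x \<in> carrier V" and y: "y \<in> carrier V"
  shows "Re (ip x y) \<le> nrm x * nrm y"
proof (cases "y = \<zero>")
  case True
  thus ?thesis using x by (simp add: nrm_def)
next
  case False
  define a r b where "a = Re (ip x x)" and "r = Re (ip x y)" and "b = Re (ip y y)"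
  have b: "b > 0" unfolding b_def using y False by (rule ip_pos)
  define t where "t = - r / b"
  let ?z = "x \<oplus> complex_of_real t \<odot>\<^bsub>V\<^esub> y"
  have "0 \<le> Re (ip ?z ?z)"
    using x y by (intro ip_self_nonneg) auto
  also have "Re (ip ?z ?z) = a + 2 * t * r + t\<^sup>2 * b"
    using x y Re_ip_commute[OF x y]
    by (simp add: ip_add_left ip_add_right ip_smult_left ip_smult_right a_def r_def b_def
        power2_eq_square algebra_simps)
  also have "\<dots> = a - r\<^sup>2 / b"
    using b by (simp add: t_def power2_eq_square field_simps)
  finally have "r\<^sup>2 \<le> a * b"
    using b by (simp add: field_simps)
  hence "r \<le> sqrt (a * b)"
    by (rule real_le_rsqrt)
  thus ?thesis
    by (simp add: nrm_def a_def b_def r_def real_sqrt_mult)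
qed

lemma nrm_triangle:
  assumes x: "x \<in> carrier V" and y: "y \<in> carrier V"
  shows "nrm (x \<oplus> y) \<le> nrm x + nrm y"
proof -
  have "0 \<le> Re (ip (x \<oplus> y) (x \<oplus> y))"
    using x y by (intro ip_self_nonneg) auto
  hence "(nrm (x \<oplus> y))\<^sup>2 = Re (ip (x \<oplus> y) (x \<oplus> y))"
    by (simp add: nrm_def)
  also have "\<dots> = (nrm x)\<^sup>2 + 2 * Re (ip x y) + (nrm y)\<^sup>2"
    using x y Re_ip_commute[OF x y] ip_self_nonneg
    by (simp add: nrm_def ip_add_left ip_add_right)
  also have "\<dots> \<le> (nrm x + nrm y)\<^sup>2"
    using Re_ip_le[OF x y] by (simp add: power2_sum)
  finally show ?thesis
    by (rule power2_le_imp_le) (use x y ip_self_nonneg in \<open>simp add: nrm_def\<close>)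
qed

lemma nrm_minus: "x \<in> carrier V \<Longrightarrow> nrm (\<ominus> x) = nrm x"
proof -
  assume x: "x \<in> carrier V"
  have "ip (\<ominus> x) z = - ip x z" if "z \<in> carrier V" for z
    using ip_add_left[of x "\<ominus> x" z] x that
    by (simp add: M.r_neg add_eq_0_iff)
  moreover have "ip z (\<ominus> x) = - ip z x" if "z \<in> carrier V" for z
    using ip_add_right[of z x "\<ominus> x"] x that
    by (simp add: M.r_neg add_eq_0_iff)
  ultimately show ?thesis
    using x by (simp add: nrm_def)
qed

lemma nrm_nonneg: "x \<in> carrier V \<Longrightarrow> 0 \<le> nrm x"
  by (simp add: nrm_def ip_self_nonneg)

lemma nrm_eq_0: "x \<in> carrier V \<Longrightarrow> nrm x = 0 \<longleftrightarrow> x = \<zero>"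
  by (simp add: nrm_def ip_self_eq_0)

sublocale metric: Metric_space "carrier V" dst
proof
  fix x y
  show "0 \<le> dst x y"
    by (simp add: dst_def nrm_nonneg)
  have "nrm (x \<ominus> y) = nrm (y \<ominus> x)" if "x \<in> carrier V" "y \<in> carrier V"
    using nrm_minus[of "x \<ominus> y"] that by (simp add: a_minus_def M.minus_add M.a_comm)
  thus "dst x y = dst y x"
    by (simp add: dst_def)
  assume x: "x \<in> carrier V" and y: "y \<in> carrier V"
  show "dst x y = 0 \<longleftrightarrow> x = y"
    using x y by (simp add: dst_def nrm_eq_0)
  fix z assume z: "z \<in> carrier V"
  have "(x \<ominus> y) \<oplus> (y \<ominus> z) = (x \<oplus> (\<ominus> y \<oplus> y)) \<oplus> \<ominus> z"
    using x y z unfolding a_minus_def by (simp only: M.a_assoc M.a_closed M.a_inv_closed)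
  also have "\<dots> = x \<ominus> z"
    using x y z by (simp add: a_minus_def M.l_neg)
  finally show "dst x z \<le> dst x y + dst y z"
    using x y z nrm_triangle[of "x \<ominus> y" "y \<ominus> z"] by (simp add: dst_def)
qed

definition bounded_operators :: "('v \<Rightarrow> 'v) set" where
  "bounded_operators = {T \<in> endomorphisms V. \<exists>C. \<forall>x \<in> carrier V. nrm (T x) \<le> C * nrm x}"

end

locale separable_hilbert_space = complex_inner_product_space +
  assumes complete: "metric.mcomplete"
    and separable: "separable_space metric.mtopology"

definition Lambda_bd_on :: "'v itself \<Rightarrow> nat \<Rightarrow> complex set" where
  "Lambda_bd_on _ n =
    {lam. \<exists>(V :: (complex, 'v) module) ip (Q :: nat \<Rightarrow> 'v \<Rightarrow> 'v).
       separable_hilbert_space V ip \<and> carrier V \<noteq> {\<zero>\<^bsub>V\<^esub>} \<and>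
       (\<forall>k \<in> {1..n}. Q k \<in> complex_inner_product_space.bounded_operators V ip \<and>
          (\<forall>v \<in> carrier V. Q k (Q k v) = Q k v)) \<and>
       (\<forall>v \<in> carrier V. (\<Oplus>\<^bsub>V\<^esub>k \<in> {1..n}. Q k v) = lam \<odot>\<^bsub>V\<^esub> v)}"

section \<open>The parameter sets\<close>

text \<open>Existence over all spaces cannot range over types, so the carriers are subsets of one fixed
  type, whose cardinality is the continuum. Nothing is lost: \<open>Lambda_fd_on_subset\<close> and
  \<open>Lambda_bd_on_subset\<close> below show that spaces carried by any other type yield no further
  parameters.\<close>

type_synonym universe = "nat \<Rightarrow> complex"

definition Lambda_fd :: "nat \<Rightarrow> complex set" where
  "Lambda_fd n = Lambda_fd_on TYPE(universe) n"

definition Lambda_bd :: "nat \<Rightarrow> complex set" where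
  "Lambda_bd n = Lambda_bd_on TYPE(universe) n"

section \<open>Independence of the carrier type\<close>

definition transport :: "('v \<Rightarrow> 'w) \<Rightarrow> (complex, 'v) module \<Rightarrow> (complex, 'w) module" where
  "transport f V = (let g = inv_into (carrier V) f in
    \<lparr>carrier = f ` carrier V, mult = (\<lambda>x y. f (g x \<otimes>\<^bsub>V\<^esub> g y)), one = f \<one>\<^bsub>V\<^esub>,
     zero = f \<zero>\<^bsub>V\<^esub>, add = (\<lambda>x y. f (g x \<oplus>\<^bsub>V\<^esub> g y)), smult = (\<lambda>c x. f (c \<odot>\<^bsub>V\<^esub> g x))\<rparr>)"

locale transported = vectorspace "class_ring :: complex ring" V
  for V :: "(complex, 'v) module" (structure) +
  fixes f :: "'v \<Rightarrow> 'w"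
  assumes inj: "inj_on f (carrier V)"
begin

abbreviation "g \<equiv> inv_into (carrier V) f"
abbreviation "W \<equiv> transport f V"

lemma W_simps:
  "carrier W = f ` carrier V" "\<zero>\<^bsub>W\<^esub> = f \<zero>\<^bsub>V\<^esub>"
  "\<lbrakk>x \<in> carrier V; y \<in> carrier V\<rbrakk> \<Longrightarrow> f x \<oplus>\<^bsub>W\<^esub> f y = f (x \<oplus>\<^bsub>V\<^esub> y)"
  "x \<in> carrier V \<Longrightarrow> c \<odot>\<^bsub>W\<^esub> f x = f (c \<odot>\<^bsub>V\<^esub> x)"
  using inj by (simp_all add: transport_def Let_def)

lemma gf [simp]: "x \<in> carrier V \<Longrightarrow> g (f x) = x"
  using inj by simp

sublocale W: vectorspace "class_ring :: complex ring" W
proof (intro vectorspace.intro moduleI abelian_groupI)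
  show "cring (class_ring :: complex ring)" "field (class_ring :: complex ring)"
    by (rule is_cring field_axioms)+
  fix x assume "x \<in> carrier W"
  then obtain v where "v \<in> carrier V" "x = f v" by (auto simp: W_simps)
  thus "\<exists>y\<in>carrier W. y \<oplus>\<^bsub>W\<^esub> x = \<zero>\<^bsub>W\<^esub>"
    by (intro bexI[of _ "f (\<ominus> v)"]) (auto simp: W_simps M.l_neg)
qed (auto simp: W_simps M.a_ac smult_l_distr[simplified] smult_r_distr[simplified]
    smult_assoc1[simplified] smult_one[simplified])

lemma W_minus:
  assumes "x \<in> carrier V" "y \<in> carrier V"
  shows "f x \<ominus>\<^bsub>W\<^esub> f y = f (x \<ominus> y)"
proof -
  have "\<ominus>\<^bsub>W\<^esub> f y = f (\<ominus> y)"
    using assms by (intro W.M.minus_equality) (auto simp: W_simps M.l_neg)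
  thus ?thesis
    using assms by (simp add: a_minus_def W_simps)
qed

lemma W_finsum:
  assumes "finite K" "\<And>k. k \<in> K \<Longrightarrow> h k \<in> carrier V"
  shows "(\<Oplus>\<^bsub>W\<^esub>k \<in> K. f (h k)) = f (\<Oplus>k \<in> K. h k)"
  using assms
proof (induction K rule: finite_induct)
  case (insert k K)
  thus ?case
    by (subst W.M.finsum_insert, simp, simp)
       (auto simp: W_simps Pi_def intro!: M.finsum_closed)
qed (simp add: W_simps)

lemma endomorphism_transport:
  assumes "T \<in> endomorphisms V"
  shows "f \<circ> T \<circ> g \<in> endomorphisms W"
  using assms by (auto simp: endomorphisms_def module_hom_def W_simps Pi_def)

lemma W_fin_dim:
  assumes "fin_dim"
  shows "W.fin_dim"
proof -
  obtain A where A: "finite A" "A \<subseteq> carrier V" "span A = carrier V"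
    using assms by (auto simp: fin_dim_def)
  have sub: "f ` A \<subseteq> carrier W" using A by (auto simp: W_simps)
  have "carrier W \<subseteq> W.span (f ` A)"
  proof
    fix w assume "w \<in> carrier W"
    then obtain v where v: "v \<in> carrier V" "w = f v" by (auto simp: W_simps)
    obtain a where a: "v = lincomb a A"
      using finite_in_span[OF A(1,2), of v] v A(3) by auto
    have "w = (\<Oplus>\<^bsub>W\<^esub>x \<in> A. f (a x \<odot>\<^bsub>V\<^esub> x))"
      using A by (subst W_finsum) (auto simp: v a lincomb_def)
    also have "\<dots> = (\<Oplus>\<^bsub>W\<^esub>x \<in> A. a (g (f x)) \<odot>\<^bsub>W\<^esub> f x)"
      using A by (intro W.M.finsum_cong') (auto simp: W_simps)
    also have "\<dots> = (\<Oplus>\<^bsub>W\<^esub>y \<in> f ` A. a (g y) \<odot>\<^bsub>W\<^esub> y)"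
      using A by (subst W.M.finsum_reindex) (auto simp: W_simps intro: inj_on_subset[OF inj])
    finally have "w = W.lincomb (a \<circ> g) (f ` A)"
      by (simp add: W.lincomb_def)
    thus "w \<in> W.span (f ` A)"
      using A sub by (subst W.finite_span) auto
  qed
  moreover have "W.span (f ` A) \<subseteq> carrier W"
    using sub by (rule W.span_is_subset2)
  ultimately show ?thesis
    using A(1) sub unfolding W.fin_dim_def by (intro exI[of _ "f ` A"]) auto
qed

lemma representation_transport:
  assumes "representation A V \<pi>"
  shows "representation A W (\<lambda>a. f \<circ> \<pi> a \<circ> g)"
proof -
  have cl: "\<pi> a v \<in> carrier V" if "a \<in> carrier A" "v \<in> carrier V" for a v
    using assms that by (auto simp: representation_def endomorphisms_def module_hom_def)
  show ?thesis
    unfolding representation_def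
    using assms endomorphism_transport cl by (auto simp: representation_def W_simps)
qed

lemma W_nonzero: "carrier V \<noteq> {\<zero>} \<Longrightarrow> carrier W \<noteq> {\<zero>\<^bsub>W\<^esub>}"
  using inj by (auto simp: W_simps) (metis M.zero_closed image_eqI inj_onD singletonD)

end

lemma Lambda_fd_on_subset: "Lambda_fd_on TYPE('v) n \<subseteq> Lambda_fd n"
proof
  fix lam assume "lam \<in> Lambda_fd_on TYPE('v) n"
  then obtain V :: "(complex, 'v) module" and \<pi> where
    V: "vectorspace class_ring V" "vectorspace.fin_dim class_ring V" "carrier V \<noteq> {\<zero>\<^bsub>V\<^esub>}"
       "representation (Q_algebra n lam) V \<pi>"
    by (auto simp: Lambda_fd_on_def)
  interpret V: vectorspace "class_ring :: complex ring" V by fact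
  obtain A where A: "finite A" "A \<subseteq> carrier V" "V.span A = carrier V"
    using V(2) by (auto simp: V.fin_dim_def)
  have "\<forall>v \<in> carrier V. \<exists>a. v = V.lincomb a A"
    using V.finite_in_span[OF A(1,2)] A(3) by blast
  then obtain a where a: "\<And>v. v \<in> carrier V \<Longrightarrow> v = V.lincomb (a v) A"
    by metis
  define f :: "'v \<Rightarrow> universe" where "f v = a v \<circ> from_nat_into A" for v
  have "inj_on f (carrier V)"
  proof
    fix v w assume v: "v \<in> carrier V" and w: "w \<in> carrier V" and eq: "f v = f w"
    have "a v x = a w x" if "x \<in> A" for x
      using fun_cong[OF eq, of "to_nat_on A x"] that A(1) by (simp add: f_def countable_finite)
    hence "V.lincomb (a v) A = V.lincomb (a w) A"
      using A(2) unfolding V.lincomb_def by (intro V.M.finsum_cong') auto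
    thus "v = w" using a v w by metis
  qed
  then interpret transported V f by unfold_locales
  show "lam \<in> Lambda_fd n"
    unfolding Lambda_fd_def Lambda_fd_on_def
    using W.vectorspace_axioms W_fin_dim W_nonzero representation_transport V by blast
qed


context complex_inner_product_space
begin

lemma transport_hilbert:
  fixes f :: "'v \<Rightarrow> 'w"
  assumes inj: "inj_on f (carrier V)"
    and complete: "metric.mcomplete" and separable: "separable_space metric.mtopology"
  defines "g \<equiv> inv_into (carrier V) f"
  defines "jp \<equiv> (\<lambda>x y. ip (g x) (g y))"
  shows "separable_hilbert_space (transport f V) jp"
    and "T \<in> bounded_operators \<Longrightarrow>
      f \<circ> T \<circ> g \<in> complex_inner_product_space.bounded_operators (transport f V) jp"
proof -
  interpret transported V f
    using inj by unfold_locales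
  have g_eq: "g = inv_into (carrier V) f" by (simp add: g_def)
  have jp: "jp (f x) (f y) = ip x y" if "x \<in> carrier V" "y \<in> carrier V" for x y
    using that by (simp add: jp_def g_eq)
  interpret H: complex_inner_product_space W jp
  proof
    fix x assume "x \<in> carrier W" "x \<noteq> \<zero>\<^bsub>W\<^esub>"
    thus "0 < Re (jp x x)" by (auto simp: W_simps jp intro!: ip_pos)
  qed (auto simp: W_simps jp ip_add_left ip_smult_left intro: ip_cnj)
  have nrm: "H.nrm (f x) = nrm x" if "x \<in> carrier V" for x
    using that by (simp add: nrm_def H.nrm_def jp)
  have dst: "H.dst (f x) (f y) = dst x y" if "x \<in> carrier V" "y \<in> carrier V" for x y
    using that by (simp add: dst_def H.dst_def W_minus nrm W_simps(1))
  show "separable_hilbert_space W jp"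
  proof
    show "H.metric.mcomplete"
      unfolding H.metric.mcomplete_def
    proof (intro allI impI)
      fix s assume s: "H.metric.MCauchy s"
      define t where "t = g \<circ> s"
      have "range s \<subseteq> carrier W"
        using s unfolding H.metric.MCauchy_def by blast
      hence "s n \<in> f ` carrier V" for n
        unfolding W_simps(1) by blast
      hence t: "t n \<in> carrier V" "s n = f (t n)" for n
        by (simp_all add: t_def g_eq f_inv_into_f inv_into_into)
      have "metric.MCauchy t"
        using s t unfolding H.metric.MCauchy_def metric.MCauchy_def
        by (auto simp: dst)
      then obtain x where "limitin metric.mtopology t x sequentially"
        using complete by (auto simp: metric.mcomplete_def)
      hence "limitin H.metric.mtopology s (f x) sequentially"
        using t unfolding metric.limitin_metric H.metric.limitin_metric
        by (auto simp: dst W_simps(1))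
      thus "\<exists>x. limitin H.metric.mtopology s x sequentially" ..
    qed
    obtain D where D: "countable D" "D \<subseteq> carrier V"
      and dense: "metric.mtopology closure_of D = carrier V"
      using separable by (auto simp: separable_space_def)
    have "H.metric.mtopology closure_of (f ` D) = carrier W"
    proof -
      have "\<exists>y\<in>f ` D. f x \<in> carrier W \<and> y \<in> carrier W \<and> H.dst (f x) y < r"
        if "x \<in> carrier V" "r > 0" for x r
      proof -
        have "x \<in> metric.mtopology closure_of D" using dense that by simp
        then obtain y where "y \<in> D" "dst x y < r"
          using \<open>r > 0\<close> unfolding metric.metric_closure_of metric.in_mball by blast
        moreover have "y \<in> carrier V" using D \<open>y \<in> D\<close> by auto
        ultimately show ?thesis
          using that by (intro bexI[of _ "f y"]) (auto simp: dst W_simps(1))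
      qed
      thus ?thesis
        unfolding H.metric.metric_closure_of H.metric.in_mball by (auto simp: W_simps(1))
    qed
    thus "separable_space H.metric.mtopology"
      using D unfolding separable_space_def H.metric.topspace_mtopology
      by (intro exI[of _ "f ` D"]) (auto simp: W_simps(1))
  qed
  show "f \<circ> T \<circ> g \<in> H.bounded_operators" if T: "T \<in> bounded_operators"
  proof -
    have T_end: "T \<in> endomorphisms V" using T by (simp add: bounded_operators_def)
    hence cl: "T x \<in> carrier V" if "x \<in> carrier V" for x
      using that by (auto simp: endomorphisms_def module_hom_def)
    obtain C where "\<forall>x \<in> carrier V. nrm (T x) \<le> C * nrm x"
      using T by (auto simp: bounded_operators_def)
    hence "\<forall>x \<in> carrier W. H.nrm ((f \<circ> T \<circ> g) x) \<le> C * H.nrm x"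
      using cl by (auto simp: W_simps(1) g_eq nrm)
    thus ?thesis
      using endomorphism_transport[OF T_end] by (auto simp: H.bounded_operators_def g_eq)
  qed
qed

end

lemma (in separable_hilbert_space) ex_inj_universe:
  "\<exists>f :: 'a \<Rightarrow> universe. inj_on f (carrier V)"
proof -
  obtain D where D: "countable D" "D \<subseteq> carrier V"
    and dense: "metric.mtopology closure_of D = carrier V"
    using separable by (auto simp: separable_space_def)
  have approx: "\<exists>d\<in>D. dst z d < r" if "z \<in> carrier V" "r > 0" for z r
  proof -
    have "z \<in> metric.mtopology closure_of D" using dense that by simp
    thus ?thesis using \<open>r > 0\<close> unfolding metric.metric_closure_of metric.in_mball by blast
  qed
  have "inj_on (\<lambda>v n. ip v (from_nat_into D n)) (carrier V)"
  proof
    fix x y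
    assume x: "x \<in> carrier V" and y: "y \<in> carrier V"
      and eq: "(\<lambda>n. ip x (from_nat_into D n)) = (\<lambda>n. ip y (from_nat_into D n))"
    let ?z = "x \<ominus> y"
    have z: "?z \<in> carrier V" using x y by simp
    have ipD: "ip x d = ip y d" if "d \<in> D" for d
      using fun_cong[OF eq, of "to_nat_on D d"] that D(1) by simp
    have orth: "ip ?z d = 0" if "d \<in> D" for d
    proof -
      have d: "d \<in> carrier V" using that D by auto
      have "x = ?z \<oplus> y" using x y by (simp add: a_minus_def M.a_assoc M.l_neg)
      hence "ip x d = ip ?z d + ip y d" using ip_add_left[OF z y d] by simp
      thus ?thesis using ipD[OF that] by simp
    qed
    have "nrm ?z \<le> r" if "r > 0" for r
    proof -
      obtain d where d: "d \<in> D" "dst ?z d < r" using approx[OF z \<open>r > 0\<close>] by blast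
      have dV: "d \<in> carrier V" using d D by auto
      have nd: "nrm (?z \<ominus> d) < r" using d z dV by (simp add: dst_def)
      have w: "?z \<ominus> d \<in> carrier V" using z dV by simp
      have "?z = (?z \<ominus> d) \<oplus> d" using z dV unfolding a_minus_def[of V ?z d] by (simp add: M.a_assoc M.l_neg)
      hence "ip ?z ?z = ip (?z \<ominus> d) ?z"
        using ip_add_left[OF w dV z] orth[OF d(1)] ip_cnj[OF z dV] by simp
      hence "Re (ip ?z ?z) \<le> nrm (?z \<ominus> d) * nrm ?z"
        using Re_ip_le[OF w z] by simp
      hence "nrm ?z * nrm ?z \<le> nrm (?z \<ominus> d) * nrm ?z"
        using ip_self_nonneg[OF z] by (simp add: nrm_def)
      hence "nrm ?z = 0 \<or> nrm ?z \<le> nrm (?z \<ominus> d)"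
        using nrm_nonneg[OF z] by (auto simp: mult_le_cancel_right)
      thus ?thesis using nd that by linarith
    qed
    hence "nrm ?z \<le> 0" by (rule field_le_epsilon[of _ 0, simplified])
    hence "?z = \<zero>" using nrm_nonneg[OF z] nrm_eq_0[OF z] by simp
    thus "x = y" using x y by simp
  qed
  thus ?thesis by blast
qed

lemma Lambda_bd_on_subset: "Lambda_bd_on TYPE('v) n \<subseteq> Lambda_bd n"
proof
  fix lam assume "lam \<in> Lambda_bd_on TYPE('v) n"
  then obtain V :: "(complex, 'v) module" and ip and Q :: "nat \<Rightarrow> 'v \<Rightarrow> 'v" where
    V: "separable_hilbert_space V ip" "carrier V \<noteq> {\<zero>\<^bsub>V\<^esub>}"
    and Q: "\<And>k. k \<in> {1..n} \<Longrightarrow> Q k \<in> complex_inner_product_space.bounded_operators V ip"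
      "\<And>k v. \<lbrakk>k \<in> {1..n}; v \<in> carrier V\<rbrakk> \<Longrightarrow> Q k (Q k v) = Q k v"
    and lam: "\<And>v. v \<in> carrier V \<Longrightarrow> (\<Oplus>\<^bsub>V\<^esub>k \<in> {1..n}. Q k v) = lam \<odot>\<^bsub>V\<^esub> v"
    unfolding Lambda_bd_on_def by blast
  interpret V: separable_hilbert_space V ip by fact
  obtain f :: "'v \<Rightarrow> universe" where f: "inj_on f (carrier V)"
    using V.ex_inj_universe by blast
  then interpret transported V f by unfold_locales
  have cl: "Q k v \<in> carrier V" if "k \<in> {1..n}" "v \<in> carrier V" for k v
    using Q(1)[OF that(1)] that(2)
    by (auto simp: V.bounded_operators_def endomorphisms_def module_hom_def)
  note H = V.transport_hilbert[OF f V.complete V.separable]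
  have "(\<Oplus>\<^bsub>W\<^esub>k \<in> {1..n}. (f \<circ> Q k \<circ> g) w) = lam \<odot>\<^bsub>W\<^esub> w" if "w \<in> carrier W" for w
  proof -
    obtain v where v: "v \<in> carrier V" "w = f v" using \<open>w \<in> carrier W\<close> by (auto simp: W_simps)
    have "(\<Oplus>\<^bsub>W\<^esub>k \<in> {1..n}. f (Q k v)) = f (\<Oplus>\<^bsub>V\<^esub>k \<in> {1..n}. Q k v)"
      using v cl by (intro W_finsum) auto
    thus ?thesis using v lam by (simp add: W_simps)
  qed
  moreover have "(f \<circ> Q k \<circ> g) ((f \<circ> Q k \<circ> g) w) = (f \<circ> Q k \<circ> g) w"
    if "k \<in> {1..n}" "w \<in> carrier W" for k w
    using that cl Q(2) by (auto simp: W_simps(1))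
  ultimately show "lam \<in> Lambda_bd n"
    unfolding Lambda_bd_def Lambda_bd_on_def
    using H(1) H(2)[OF Q(1)] W_nonzero[OF V(2)]
    by (intro CollectI exI[of _ W] exI[of _ "\<lambda>x y. ip (g x) (g y)"] exI[of _ "\<lambda>k. f \<circ> Q k \<circ> g"])
       blast
qed

end

theory Submission
  imports Defs
begin

text \<open>
  Write \<open>lam = 2 + \<mu>\<close> and, for idempotents \<open>q\<^sub>1, \<dots>, q\<^sub>4\<close> with sum \<open>lam\<close>, put \<open>x = q\<^sub>1 + q\<^sub>2 - 1\<close>, \<open>d = q\<^sub>1 - q\<^sub>2\<close>,
  \<open>y = q\<^sub>3 + q\<^sub>4 - 1\<close>, \<open>e = q\<^sub>3 - q\<^sub>4\<close>. The hypotheses become \<open>x d = - d x\<close>, \<open>x\<^sup>2 + d\<^sup>2 = 1\<close>, \<open>y e = - e y\<close>,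
  \<open>y\<^sup>2 + e\<^sup>2 = 1\<close> and \<open>x + y = \<mu>\<close>. So \<open>d\<close> takes an eigenvector of \<open>x\<close> for \<open>t\<close> to one for \<open>- t\<close>, unless
  \<open>t\<^sup>2 = 1\<close>, and \<open>e\<close> takes it to one for \<open>2 \<mu> - t\<close>, unless \<open>(\<mu> - t)\<^sup>2 = 1\<close>. The parameters are those for which
  the chain of alternating reflections, started at \<open>\<plusminus>1\<close>, terminates.

  The proof runs around the cycle of inclusions fd, bd, explicit set, fd.

  \<^item> A finite-dimensional space becomes a separable Hilbert space through coordinates, and all its
    operators are bounded (\<open>Lambda_fd_on_subset_bd\<close>).

  \<^item> Let the operators be bounded and \<open>\<mu> \<noteq> 0\<close>. From \<open>x (e d) = (e d) (x + 2 \<mu>)\<close> it follows that \<open>e d\<close> is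
    nilpotent (\<open>nilpotent_of_commutator\<close>), so \<open>d\<close> or \<open>e\<close> has a kernel and \<open>x\<close> or \<open>y\<close> an eigenvalue
    \<open>\<plusminus>1\<close>. The chain that starts there stays bounded, hence stops, which forces \<open>k \<mu> = \<plusminus>2\<close> for some
    \<open>k \<ge> 1\<close> (\<open>offset_of_eigenvector\<close>, \<open>offset_values\<close>).

  \<^item> Conversely, if \<open>k \<mu> = \<plusminus>2\<close>, a chain of length \<open>k\<close> defines four idempotents on a
    \<open>k\<close>-dimensional space (\<open>chain_parameter_in_Lambda_fd\<close>). Operators that satisfy the relations
    amount to a representation of the quotient algebra (\<open>Lambda_fd_of_operators\<close>). For \<open>\<mu> = 0\<close>, the scalars
    \<open>1, 1, 0, 0\<close> do.
\<close>

section \<open>Bounded operators on an inner product space\<close>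

context complex_inner_product_space
begin

text \<open>Testing against all vectors turns an identity between combinations of operators into a
  polynomial identity in complex numbers, which the simplifier can settle.\<close>

lemma vec_eqI:
  assumes x: "x \<in> carrier V" and y: "y \<in> carrier V"
    and eq: "\<And>z. z \<in> carrier V \<Longrightarrow> ip x z = ip y z"
  shows "x = y"
proof -
  have z: "x \<ominus> y \<in> carrier V" using x y by simp
  have "x = (x \<ominus> y) \<oplus> y" using x y by (simp add: a_minus_def M.a_assoc M.l_neg)
  hence "ip x (x \<ominus> y) = ip (x \<ominus> y) (x \<ominus> y) + ip y (x \<ominus> y)"
    using ip_add_left[OF z y z] by simp
  hence "x \<ominus> y = \<zero>"
    using eq[OF z] ip_self_eq_0[OF z] by simp
  thus ?thesis using x y by simp
qed

lemma nrm_smult: "x \<in> carrier V \<Longrightarrow> nrm (c \<odot>\<^bsub>V\<^esub> x) = cmod c * nrm x"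
proof -
  assume x: "x \<in> carrier V"
  have "ip (c \<odot>\<^bsub>V\<^esub> x) (c \<odot>\<^bsub>V\<^esub> x) = (c * cnj c) * ip x x"
    using x by (simp add: ip_smult_left ip_smult_right)
  hence "Re (ip (c \<odot>\<^bsub>V\<^esub> x) (c \<odot>\<^bsub>V\<^esub> x)) = (cmod c)\<^sup>2 * Re (ip x x)"
    by (simp only: complex_norm_square[symmetric] Re_complex_of_real) (simp del: of_real_power)
  thus ?thesis by (simp add: nrm_def real_sqrt_mult)
qed

lemma operatorD:
  assumes "T \<in> endomorphisms V"
  shows "x \<in> carrier V \<Longrightarrow> T x \<in> carrier V"
    and "\<lbrakk>x \<in> carrier V; y \<in> carrier V\<rbrakk> \<Longrightarrow> T (x \<oplus> y) = T x \<oplus> T y"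
    and "x \<in> carrier V \<Longrightarrow> T (c \<odot>\<^bsub>V\<^esub> x) = c \<odot>\<^bsub>V\<^esub> T x"
  using assms by (auto simp: endomorphisms_def module_hom_def)

lemma smult_eq_zero_iff:
  assumes "x \<in> carrier V" "x \<noteq> \<zero>"
  shows "c \<odot>\<^bsub>V\<^esub> x = \<zero> \<longleftrightarrow> c = 0"
  using nrm_smult[OF assms(1), of c] nrm_eq_0[of "c \<odot>\<^bsub>V\<^esub> x"] nrm_eq_0[of x] assms by simp


lemma bounded_operatorE:
  assumes "T \<in> bounded_operators"
  obtains C where "C > 0" "\<And>x. x \<in> carrier V \<Longrightarrow> nrm (T x) \<le> C * nrm x"
proof -
  obtain C where C: "\<forall>x \<in> carrier V. nrm (T x) \<le> C * nrm x"
    using assms by (auto simp: bounded_operators_def)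
  have "nrm (T x) \<le> max 1 C * nrm x" if "x \<in> carrier V" for x
    using C that nrm_nonneg[OF that] mult_right_mono[of C "max 1 C" "nrm x"] by fastforce
  thus ?thesis using that[of "max 1 C"] by simp
qed

lemma id_bounded: "(\<lambda>v. v) \<in> bounded_operators"
  by (auto simp: bounded_operators_def endomorphisms_def module_hom_def intro!: exI[of _ 1])

lemma smult_bounded:
  assumes "T \<in> bounded_operators"
  shows "(\<lambda>v. c \<odot>\<^bsub>V\<^esub> T v) \<in> bounded_operators"
proof -
  obtain C where C: "C > 0" "\<And>x. x \<in> carrier V \<Longrightarrow> nrm (T x) \<le> C * nrm x"
    using bounded_operatorE[OF assms] by blast
  have T: "T \<in> endomorphisms V" using assms by (simp add: bounded_operators_def)
  note [simp] = operatorD[OF T]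
  have "nrm (c \<odot>\<^bsub>V\<^esub> T x) \<le> (cmod c * C) * nrm x" if "x \<in> carrier V" for x
    using C(2)[OF that] that by (simp add: nrm_smult mult.assoc mult_left_mono)
  moreover have "(\<lambda>v. c \<odot>\<^bsub>V\<^esub> T v) \<in> endomorphisms V"
    by (auto simp: endomorphisms_def module_hom_def ip_smult_left ip_add_left algebra_simps
        intro!: vec_eqI)
  ultimately show ?thesis by (auto simp: bounded_operators_def)
qed

lemma add_bounded:
  assumes "S \<in> bounded_operators" "T \<in> bounded_operators"
  shows "(\<lambda>v. S v \<oplus> T v) \<in> bounded_operators"
proof -
  obtain B where B: "B > 0" "\<And>x. x \<in> carrier V \<Longrightarrow> nrm (S x) \<le> B * nrm x"
    using bounded_operatorE[OF assms(1)] by blast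
  obtain C where C: "C > 0" "\<And>x. x \<in> carrier V \<Longrightarrow> nrm (T x) \<le> C * nrm x"
    using bounded_operatorE[OF assms(2)] by blast
  have S: "S \<in> endomorphisms V" and T: "T \<in> endomorphisms V"
    using assms by (simp_all add: bounded_operators_def)
  note [simp] = operatorD[OF S] operatorD[OF T]
  have "nrm (S x \<oplus> T x) \<le> (B + C) * nrm x" if "x \<in> carrier V" for x
    using B(2)[OF that] C(2)[OF that] nrm_triangle[of "S x" "T x"] that by (simp add: algebra_simps)
  moreover have "(\<lambda>v. S v \<oplus> T v) \<in> endomorphisms V"
    by (auto simp: endomorphisms_def module_hom_def ip_smult_left ip_add_left algebra_simps
        intro!: vec_eqI)
  ultimately show ?thesis by (auto simp: bounded_operators_def)
qed

lemma comp_bounded: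
  assumes "S \<in> bounded_operators" "T \<in> bounded_operators"
  shows "(\<lambda>v. S (T v)) \<in> bounded_operators"
proof -
  obtain B where B: "B > 0" "\<And>x. x \<in> carrier V \<Longrightarrow> nrm (S x) \<le> B * nrm x"
    using bounded_operatorE[OF assms(1)] by blast
  obtain C where C: "C > 0" "\<And>x. x \<in> carrier V \<Longrightarrow> nrm (T x) \<le> C * nrm x"
    using bounded_operatorE[OF assms(2)] by blast
  have S: "S \<in> endomorphisms V" and T: "T \<in> endomorphisms V"
    using assms by (simp_all add: bounded_operators_def)
  note [simp] = operatorD[OF S] operatorD[OF T]
  have "nrm (S (T x)) \<le> (B * C) * nrm x" if "x \<in> carrier V" for x
  proof -
    have "nrm (S (T x)) \<le> B * nrm (T x)" using B(2) that by simp
    also have "\<dots> \<le> B * (C * nrm x)" using B(1) C(2)[OF that] by simp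
    finally show ?thesis by simp
  qed
  moreover have "(\<lambda>v. S (T v)) \<in> endomorphisms V"
    by (auto simp: endomorphisms_def module_hom_def)
  ultimately show ?thesis by (auto simp: bounded_operators_def)
qed

definition eigenvector :: "('v \<Rightarrow> 'v) \<Rightarrow> complex \<Rightarrow> 'v \<Rightarrow> bool" where
  "eigenvector T t u \<longleftrightarrow> u \<in> carrier V \<and> u \<noteq> \<zero> \<and> T u = t \<odot>\<^bsub>V\<^esub> u"

lemma eigenvalues_bounded:
  assumes "T \<in> bounded_operators"
  obtains C where "\<And>t u. eigenvector T t u \<Longrightarrow> cmod t \<le> C"
proof -
  obtain C where C: "C > 0" "\<And>x. x \<in> carrier V \<Longrightarrow> nrm (T x) \<le> C * nrm x"
    using bounded_operatorE[OF assms] by blast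
  have "cmod t \<le> C" if "eigenvector T t u" for t u
  proof -
    have u: "u \<in> carrier V" "u \<noteq> \<zero>" "T u = t \<odot>\<^bsub>V\<^esub> u" using that by (auto simp: eigenvector_def)
    have "nrm u > 0" using u nrm_nonneg[of u] nrm_eq_0[of u] by linarith
    moreover have "cmod t * nrm u \<le> C * nrm u" using C(2)[of u] u by (simp add: nrm_smult)
    ultimately show ?thesis by simp
  qed
  thus ?thesis using that by blast
qed

text \<open>If \<open>T\<^sup>2 u = u\<close> then \<open>T\<close> fixes \<open>T u + u\<close>, and if that vector vanishes then \<open>T\<close> negates \<open>u\<close>.\<close>

lemma eigenvector_of_square_root:
  assumes T: "T \<in> endomorphisms V" and u: "u \<in> carrier V" "u \<noteq> \<zero>" "T (T u) = u"
  obtains \<epsilon> v where "\<epsilon> \<in> {1, -1}" "eigenvector T \<epsilon> v"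
proof (cases "T u \<oplus> u = \<zero>")
  case True
  note [simp] = operatorD[OF T]
  have "ip (T u) z = - ip u z" if "z \<in> carrier V" for z
    using ip_add_left[of "T u" u z] True u that by (simp add: add_eq_0_iff2)
  hence "T u = (-1) \<odot>\<^bsub>V\<^esub> u"
    using u by (intro vec_eqI) (auto simp: ip_smult_left)
  thus ?thesis using that[of "-1" u] u by (simp add: eigenvector_def)
next
  case False
  note [simp] = operatorD[OF T]
  have "T (T u \<oplus> u) = 1 \<odot>\<^bsub>V\<^esub> (T u \<oplus> u)"
    using u by (intro vec_eqI) (auto simp: ip_add_left ip_smult_left)
  thus ?thesis using that[of 1 "T u \<oplus> u"] u False by (simp add: eigenvector_def)
qed

text \<open>The relation \<open>X W - W X = c W\<close> propagates to \<open>X W\<^sup>n - W\<^sup>n X = n c W\<^sup>n\<close>. Comparing norms gives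
  \<open>n \<bar>c\<bar> \<parallel>W\<^sup>n\<parallel> \<le> 2 \<parallel>X\<parallel> \<parallel>W\<^sup>n\<parallel>\<close>, which for large \<open>n\<close> leaves only \<open>W\<^sup>n = 0\<close>. The proof carries this
  out on vectors: any bound for \<open>W\<^sup>n\<close> may be replaced by half of it, again and again.\<close>

lemma nilpotent_of_commutator:
  assumes X: "X \<in> bounded_operators" and W: "W \<in> bounded_operators" and c: "c \<noteq> 0"
    and comm: "\<And>v. v \<in> carrier V \<Longrightarrow> X (W v) = W (X v) \<oplus> c \<odot>\<^bsub>V\<^esub> W v"
  obtains n where "\<And>v. v \<in> carrier V \<Longrightarrow> (W ^^ n) v = \<zero>"
proof -
  have "X \<in> endomorphisms V" and "W \<in> endomorphisms V"
    using X W by (simp_all add: bounded_operators_def)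
  note [simp] = operatorD[OF this(1)] operatorD[OF this(2)]
  have cl [simp]: "(W ^^ n) v \<in> carrier V" if "v \<in> carrier V" for n v
    using that by (induction n) auto
  have comm_n: "X ((W ^^ n) v) = (W ^^ n) (X v) \<oplus> (of_nat n * c) \<odot>\<^bsub>V\<^esub> (W ^^ n) v"
    if "v \<in> carrier V" for n v
  proof (induction n)
    case 0
    show ?case using that by (intro vec_eqI) (auto simp: ip_add_left ip_smult_left)
  next
    case (Suc n)
    show ?case using that
      by (intro vec_eqI) (auto simp: comm Suc ip_add_left ip_smult_left algebra_simps)
  qed
  obtain C where C: "C > 0" "\<And>x. x \<in> carrier V \<Longrightarrow> nrm (X x) \<le> C * nrm x"
    using bounded_operatorE[OF X] by blast
  obtain B where B: "B > 0" "\<And>x. x \<in> carrier V \<Longrightarrow> nrm (W x) \<le> B * nrm x"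
    using bounded_operatorE[OF W] by blast
  have bound: "nrm ((W ^^ n) v) \<le> B ^ n * nrm v" if "v \<in> carrier V" for n v
  proof (induction n)
    case (Suc n)
    have "nrm ((W ^^ Suc n) v) \<le> B * nrm ((W ^^ n) v)" using B(2) that by simp
    also have "\<dots> \<le> B * (B ^ n * nrm v)" using B(1) Suc by simp
    finally show ?case by simp
  qed simp
  obtain n :: nat where n: "3 * C / cmod c < real n"
    using reals_Archimedean2 by blast
  have n': "3 * C \<le> real n * cmod c" using n c by (simp add: field_simps)
  \<comment> \<open>From any bound \<open>K\<close> for \<open>W\<^sup>n\<close>, the choice of \<open>n\<close> produces the bound \<open>K / 2\<close>.\<close>
  have halving: "nrm ((W ^^ n) v) \<le> B ^ n * (1 / 2) ^ j * nrm v" if "v \<in> carrier V" for v j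
    using that
  proof (induction j arbitrary: v)
    case 0
    thus ?case using bound by simp
  next
    case (Suc j)
    let ?w = "(W ^^ n) v" and ?K = "B ^ n * (1 / 2) ^ j"
    note v = Suc.prems
    have "(of_nat n * c) \<odot>\<^bsub>V\<^esub> ?w = X ?w \<oplus> (-1) \<odot>\<^bsub>V\<^esub> (W ^^ n) (X v)"
      using v by (intro vec_eqI) (auto simp: comm_n ip_add_left ip_smult_left)
    hence "real n * cmod c * nrm ?w = nrm (X ?w \<oplus> (-1) \<odot>\<^bsub>V\<^esub> (W ^^ n) (X v))"
      using v nrm_smult[of ?w "of_nat n * c"] by (simp add: norm_mult)
    also have "\<dots> \<le> nrm (X ?w) + nrm ((W ^^ n) (X v))"
      using v nrm_triangle[of "X ?w" "(-1) \<odot>\<^bsub>V\<^esub> (W ^^ n) (X v)"] by (simp add: nrm_smult)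
    also have "nrm (X ?w) \<le> C * nrm ?w" using C(2) v by simp
    also have "nrm ((W ^^ n) (X v)) \<le> ?K * nrm (X v)" using Suc.IH v by simp
    also have "?K * nrm (X v) \<le> ?K * (C * nrm v)"
      using B(1) C(2) v by (intro mult_left_mono) auto
    finally have "real n * cmod c * nrm ?w \<le> C * nrm ?w + ?K * (C * nrm v)" by simp
    moreover have "3 * C * nrm ?w \<le> real n * cmod c * nrm ?w"
      using n' v by (intro mult_right_mono nrm_nonneg) auto
    ultimately have "C * (2 * nrm ?w) \<le> C * (?K * nrm v)" by (simp add: algebra_simps)
    hence "2 * nrm ?w \<le> ?K * nrm v" using C(1) by (simp only: mult_le_cancel_left_pos)
    thus ?case by simp
  qed
  have "(W ^^ n) v = \<zero>" if v: "v \<in> carrier V" for v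
  proof -
    have "(\<lambda>j. B ^ n * (1 / 2) ^ j * nrm v) \<longlonglongrightarrow> B ^ n * 0 * nrm v"
      by (intro tendsto_intros LIMSEQ_power_zero) auto
    hence "nrm ((W ^^ n) v) \<le> B ^ n * 0 * nrm v"
      by (rule LIMSEQ_le_const) (use halving[OF v] in auto)
    thus ?thesis using nrm_nonneg[of "(W ^^ n) v"] nrm_eq_0[of "(W ^^ n) v"] v by simp
  qed
  thus ?thesis using that by blast
qed

end

section \<open>Bounded idempotents with scalar sum\<close>

text \<open>For idempotents \<open>p\<close> and \<open>q\<close>, the operators \<open>x = p + q - 1\<close> and \<open>d = p - q\<close> satisfy \<open>x d = - d x\<close> and
  \<open>x\<^sup>2 + d\<^sup>2 = 1\<close>. Four idempotents with scalar sum give two such pairs whose first members add up to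
  a scalar, here called \<open>\<mu>\<close>. The two pairs play symmetric parts, which \<open>swapped\<close> below expresses.\<close>

locale opposed_pairs = complex_inner_product_space V ip
  for V :: "(complex, 'v) module" (structure) and ip +
  fixes X D Y E :: "'v \<Rightarrow> 'v" and \<mu> :: complex
  assumes bounded: "X \<in> bounded_operators" "D \<in> bounded_operators"
      "Y \<in> bounded_operators" "E \<in> bounded_operators"
    and X_D: "v \<in> carrier V \<Longrightarrow> X (D v) = (-1) \<odot>\<^bsub>V\<^esub> D (X v)"
    and D_D: "v \<in> carrier V \<Longrightarrow> D (D v) = v \<oplus> (-1) \<odot>\<^bsub>V\<^esub> X (X v)"
    and Y_E: "v \<in> carrier V \<Longrightarrow> Y (E v) = (-1) \<odot>\<^bsub>V\<^esub> E (Y v)"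
    and E_E: "v \<in> carrier V \<Longrightarrow> E (E v) = v \<oplus> (-1) \<odot>\<^bsub>V\<^esub> Y (Y v)"
    and X_Y: "v \<in> carrier V \<Longrightarrow> X v \<oplus> Y v = \<mu> \<odot>\<^bsub>V\<^esub> v"
begin

lemma endo: "X \<in> endomorphisms V" "D \<in> endomorphisms V" "Y \<in> endomorphisms V" "E \<in> endomorphisms V"
  using bounded by (simp_all add: bounded_operators_def)

lemmas operators [simp] = endo[THEN operatorD(1)] endo[THEN operatorD(2)] endo[THEN operatorD(3)]

lemma swapped: "opposed_pairs V ip Y E X D \<mu>"
  by unfold_locales (simp_all add: bounded X_D D_D Y_E E_E X_Y M.a_comm)

lemma Y_eq: "v \<in> carrier V \<Longrightarrow> Y v = \<mu> \<odot>\<^bsub>V\<^esub> v \<oplus> (-1) \<odot>\<^bsub>V\<^esub> X v"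
  by (intro vec_eqI) (auto simp: X_Y[symmetric] ip_add_left ip_smult_left)

lemma X_E: "v \<in> carrier V \<Longrightarrow> X (E v) = (2 * \<mu>) \<odot>\<^bsub>V\<^esub> E v \<oplus> (-1) \<odot>\<^bsub>V\<^esub> E (X v)"
proof (rule vec_eqI)
  fix z assume v: "v \<in> carrier V" and z: "z \<in> carrier V"
  have "ip (X (E v)) z + ip (Y (E v)) z = \<mu> * ip (E v) z"
    using X_Y[of "E v"] v z by (simp add: ip_add_left[symmetric] ip_smult_left)
  moreover have "ip (Y (E v)) z = - (\<mu> * ip (E v) z - ip (E (X v)) z)"
    using v z by (simp add: Y_E, simp add: Y_eq ip_add_left ip_smult_left)
  ultimately show "ip (X (E v)) z = ip ((2 * \<mu>) \<odot>\<^bsub>V\<^esub> E v \<oplus> (-1) \<odot>\<^bsub>V\<^esub> E (X v)) z"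
    using v z by (simp add: ip_add_left ip_smult_left algebra_simps)
qed auto

lemma D_zero: "D \<zero> = \<zero>"
proof (rule vec_eqI)
  fix z assume "z \<in> carrier V"
  thus "ip (D \<zero>) z = ip \<zero> z"
    using operatorD(3)[OF endo(2), of \<zero> 0] ip_smult_left[of "D \<zero>" z 0] by simp
qed auto

text \<open>Since \<open>D\<^sup>2 = 1 - X\<^sup>2\<close>, the operator \<open>D\<close> cannot kill an eigenvector of \<open>X\<close> unless the eigenvalue is
  \<open>\<plusminus>1\<close>; it therefore reflects eigenvalues at \<open>0\<close>. In the next lemma \<open>E\<close> reflects them at \<open>\<mu>\<close>.\<close>

lemma D_eigenvector:
  assumes "eigenvector X t u" and t: "t\<^sup>2 \<noteq> 1"
  shows "eigenvector X (- t) (D u)"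
proof -
  have u: "u \<in> carrier V" "u \<noteq> \<zero>" "X u = t \<odot>\<^bsub>V\<^esub> u" using assms by (auto simp: eigenvector_def)
  have "D (D u) = (1 - t\<^sup>2) \<odot>\<^bsub>V\<^esub> u"
    using u by (intro vec_eqI) (auto simp: D_D ip_add_left ip_smult_left algebra_simps power2_eq_square)
  hence "D (D u) \<noteq> \<zero>" using u t smult_eq_zero_iff[of u "1 - t\<^sup>2"] by simp
  hence "D u \<noteq> \<zero>" using D_zero by auto
  moreover have "X (D u) = (- t) \<odot>\<^bsub>V\<^esub> D u"
    using u by (intro vec_eqI) (auto simp: X_D ip_smult_left)
  ultimately show ?thesis using u by (simp add: eigenvector_def)
qed

lemma E_eigenvector:
  assumes "eigenvector X t u" and t: "(\<mu> - t)\<^sup>2 \<noteq> 1"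
  shows "eigenvector X (2 * \<mu> - t) (E u)"
proof -
  interpret S: opposed_pairs V ip Y E X D \<mu> by (rule swapped)
  have u: "u \<in> carrier V" "u \<noteq> \<zero>" "X u = t \<odot>\<^bsub>V\<^esub> u" using assms by (auto simp: eigenvector_def)
  have "eigenvector Y (\<mu> - t) u" unfolding eigenvector_def
    using u by (auto simp: Y_eq ip_add_left ip_smult_left algebra_simps intro!: vec_eqI)
  hence "E u \<noteq> \<zero>" using S.D_eigenvector[OF _ t] by (auto simp: eigenvector_def)
  moreover have "X (E u) = (2 * \<mu> - t) \<odot>\<^bsub>V\<^esub> E u"
    using u by (intro vec_eqI) (auto simp: X_E ip_add_left ip_smult_left algebra_simps)
  ultimately show ?thesis using u by (simp add: eigenvector_def)
qed

text \<open>Reflecting the eigenvalue \<open>\<epsilon> = \<plusminus>1\<close> alternately at \<open>\<mu>\<close> and at \<open>0\<close> would give infinitely many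
  eigenvalues \<open>\<epsilon> - 2 j \<mu>\<close> of the bounded operator \<open>X\<close>. So some reflection has to fail, and a failure at
  step \<open>k\<close> means \<open>(k \<mu> - \<epsilon>)\<^sup>2 = 1\<close>.\<close>

lemma offset_of_eigenvector:
  assumes u: "eigenvector X \<epsilon> u" and \<epsilon>: "\<epsilon> \<in> {1, -1}" and \<mu>: "\<mu> \<noteq> 0"
  shows "\<exists>k \<ge> 1. of_nat k * \<mu> = 2 * \<epsilon>"
proof (rule ccontr)
  assume "\<not> ?thesis"
  hence no: "of_nat k * \<mu> \<noteq> 2 * \<epsilon>" if "k \<ge> 1" for k using that by blast
  have sq: "(of_nat k * \<mu> - \<epsilon>)\<^sup>2 \<noteq> 1" if "k \<ge> 1" for k
  proof
    assume "(of_nat k * \<mu> - \<epsilon>)\<^sup>2 = 1"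
    moreover have "\<epsilon>\<^sup>2 = 1" using \<epsilon> by auto
    ultimately have "of_nat k * \<mu> * (of_nat k * \<mu> - 2 * \<epsilon>) = 0"
      by (simp add: power2_eq_square algebra_simps)
    thus False using no[OF that] \<mu> that by auto
  qed
  have chain: "\<exists>u. eigenvector X (\<epsilon> - of_nat (2 * j) * \<mu>) u" for j
  proof (induction j)
    case 0
    show ?case using u by auto
  next
    case (Suc j)
    then obtain u where u: "eigenvector X (\<epsilon> - of_nat (2 * j) * \<mu>) u" by blast
    have "eigenvector X (2 * \<mu> - (\<epsilon> - of_nat (2 * j) * \<mu>)) (E u)"
      using sq[of "2 * j + 1"] by (intro E_eigenvector[OF u]) (simp add: algebra_simps)
    also have "2 * \<mu> - (\<epsilon> - of_nat (2 * j) * \<mu>) = of_nat (2 * Suc j) * \<mu> - \<epsilon>"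
      by (simp add: algebra_simps)
    finally have "eigenvector X (- (of_nat (2 * Suc j) * \<mu> - \<epsilon>)) (D (E u))"
      by (rule D_eigenvector) (rule sq, simp)
    thus ?case by auto
  qed
  obtain C where C: "\<And>t u. eigenvector X t u \<Longrightarrow> cmod t \<le> C"
    using eigenvalues_bounded[OF bounded(1)] by blast
  obtain j :: nat where "(C + 1) / cmod \<mu> < real j"
    using reals_Archimedean2 by blast
  hence j: "C + 1 < real j * cmod \<mu>" using \<mu> by (simp add: field_simps)
  have "real j * cmod \<mu> \<le> real (2 * j) * cmod \<mu>" by (simp add: mult_right_mono)
  also have "\<dots> = cmod (\<epsilon> - (\<epsilon> - of_nat (2 * j) * \<mu>))" by (simp add: norm_mult)
  also have "\<dots> \<le> cmod \<epsilon> + cmod (\<epsilon> - of_nat (2 * j) * \<mu>)" by (rule norm_triangle_ineq4)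
  also have "\<dots> \<le> 1 + C" using chain[of j] C \<epsilon> by auto
  finally show False using j by simp
qed

lemma D_kernel:
  assumes v: "v \<in> carrier V" "v \<noteq> \<zero>" and "D v = \<zero>"
  shows "\<exists>\<epsilon> \<in> {1, -1}. \<exists>u. eigenvector X \<epsilon> u"
proof -
  have "v \<oplus> (-1) \<odot>\<^bsub>V\<^esub> X (X v) = \<zero>"
    using D_D[OF v(1)] assms(3) D_zero by (simp only:)
  hence "ip (X (X v)) z = ip v z" if "z \<in> carrier V" for z
    using v that ip_add_left[of v "(-1) \<odot>\<^bsub>V\<^esub> X (X v)" z] by (simp add: ip_smult_left)
  hence "X (X v) = v" using v by (intro vec_eqI) auto
  thus ?thesis using eigenvector_of_square_root[OF endo(1) v] by metis
qed

text \<open>Here an eigenvector with which to start a chain has to be found. The composition of the two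
  reflections translates: \<open>X (E D) = (E D) (X + 2 \<mu>)\<close>. For \<open>\<mu> \<noteq> 0\<close> this makes \<open>E D\<close> nilpotent, so \<open>D\<close> or \<open>E\<close>
  is not injective, and its kernel yields an eigenvector of \<open>X\<close> or \<open>Y\<close> with eigenvalue \<open>\<plusminus>1\<close>.\<close>

lemma offset_values:
  assumes nonzero: "carrier V \<noteq> {\<zero>}"
  shows "\<mu> = 0 \<or> (\<exists>k \<ge> 1. \<exists>\<epsilon> \<in> {1, -1}. of_nat k * \<mu> = 2 * \<epsilon>)"
proof (rule disjCI)
  assume "\<not> (\<exists>k \<ge> 1. \<exists>\<epsilon> \<in> {1, -1}. of_nat k * \<mu> = 2 * \<epsilon>)"
  hence no: "\<not> eigenvector X \<epsilon> u" "\<not> eigenvector Y \<epsilon> u" if "\<mu> \<noteq> 0" "\<epsilon> \<in> {1, -1}" for \<epsilon> u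
    using offset_of_eigenvector[of \<epsilon> u] opposed_pairs.offset_of_eigenvector[OF swapped, of \<epsilon> u]
      that by blast+
  show "\<mu> = 0"
  proof (rule ccontr)
    assume \<mu>: "\<mu> \<noteq> 0"
    have D_inj: "D v \<noteq> \<zero>" if "v \<in> carrier V" "v \<noteq> \<zero>" for v
      using D_kernel[OF that] no(1)[OF \<mu>] by blast
    have E_inj: "E v \<noteq> \<zero>" if "v \<in> carrier V" "v \<noteq> \<zero>" for v
      using opposed_pairs.D_kernel[OF swapped that] no(2)[OF \<mu>] by blast
    have "X (E (D v)) = E (D (X v)) \<oplus> (2 * \<mu>) \<odot>\<^bsub>V\<^esub> E (D v)" if "v \<in> carrier V" for v
      using that by (intro vec_eqI) (auto simp: X_E X_D ip_add_left ip_smult_left)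
    then obtain n where n: "\<And>v. v \<in> carrier V \<Longrightarrow> ((\<lambda>v. E (D v)) ^^ n) v = \<zero>"
      using nilpotent_of_commutator[OF bounded(1) comp_bounded[OF bounded(4,2)], of "2 * \<mu>"] \<mu> by auto
    obtain v where v: "v \<in> carrier V" "v \<noteq> \<zero>" using nonzero by auto
    have "((\<lambda>v. E (D v)) ^^ n) v \<in> carrier V \<and> ((\<lambda>v. E (D v)) ^^ n) v \<noteq> \<zero>" for n
      using v D_inj E_inj by (induction n) auto
    thus False using n[OF v(1)] by blast
  qed
qed

end

lemma (in complex_inner_product_space) sum_of_four_idempotents_values:
  assumes Q: "\<And>k. k \<in> {1..4} \<Longrightarrow> Q k \<in> bounded_operators"
    and idem: "\<And>k v. \<lbrakk>k \<in> {1..4::nat}; v \<in> carrier V\<rbrakk> \<Longrightarrow> Q k (Q k v) = Q k v"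
    and sum: "\<And>v. v \<in> carrier V \<Longrightarrow> (\<Oplus>k \<in> {1..4}. Q k v) = lam \<odot>\<^bsub>V\<^esub> v"
    and nonzero: "carrier V \<noteq> {\<zero>}"
  shows "lam = 2 \<or> (\<exists>k \<ge> 1. \<exists>\<epsilon> \<in> {1, -1}. of_nat k * (lam - 2) = 2 * \<epsilon>)"
proof -
  have endo: "Q k \<in> endomorphisms V" if "k \<in> {1..4}" for k
    using Q[OF that] by (simp add: bounded_operators_def)
  have [simp]: "Q k v \<in> carrier V" "Q k (v \<oplus> w) = Q k v \<oplus> Q k w" "Q k (c \<odot>\<^bsub>V\<^esub> v) = c \<odot>\<^bsub>V\<^esub> Q k v"
      "Q k (Q k v) = Q k v"
    if "k \<in> {1, 2, 3, 4}" "v \<in> carrier V" "w \<in> carrier V" for k v w c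
    using that operatorD[OF endo[of k]] idem[of k] by auto
  have "{1..4::nat} = {1, 2, 3, 4}" by auto
  hence sum4: "Q 1 v \<oplus> (Q 2 v \<oplus> (Q 3 v \<oplus> Q 4 v)) = lam \<odot>\<^bsub>V\<^esub> v" if "v \<in> carrier V" for v
    using sum[OF that] that by (simp add: M.finsum_insert)
  have sum4_ip: "ip (Q 4 v) z = lam * ip v z - ip (Q 1 v) z - ip (Q 2 v) z - ip (Q 3 v) z"
    if "v \<in> carrier V" "z \<in> carrier V" for v z
    using that by (simp add: ip_smult_left[symmetric] sum4[symmetric] ip_add_left)
  define X D Y E where
    "X = (\<lambda>v. Q 1 v \<oplus> (Q 2 v \<oplus> (-1) \<odot>\<^bsub>V\<^esub> v))" and "D = (\<lambda>v. Q 1 v \<oplus> (-1) \<odot>\<^bsub>V\<^esub> Q 2 v)" and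
    "Y = (\<lambda>v. Q 3 v \<oplus> (Q 4 v \<oplus> (-1) \<odot>\<^bsub>V\<^esub> v))" and "E = (\<lambda>v. Q 3 v \<oplus> (-1) \<odot>\<^bsub>V\<^esub> Q 4 v)"
  interpret opposed_pairs V ip X D Y E "lam - 2"
  proof
    show "X \<in> bounded_operators" "D \<in> bounded_operators" "Y \<in> bounded_operators" "E \<in> bounded_operators"
      unfolding X_def D_def Y_def E_def by (intro add_bounded smult_bounded id_bounded Q; simp)+
    fix v assume v: "v \<in> carrier V"
    note [simp] = X_def D_def Y_def E_def ip_add_left ip_smult_left
    show "X (D v) = (-1) \<odot>\<^bsub>V\<^esub> D (X v)" "D (D v) = v \<oplus> (-1) \<odot>\<^bsub>V\<^esub> X (X v)"
      "Y (E v) = (-1) \<odot>\<^bsub>V\<^esub> E (Y v)" "E (E v) = v \<oplus> (-1) \<odot>\<^bsub>V\<^esub> Y (Y v)"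
      using v by (auto intro!: vec_eqI)
    show "X v \<oplus> Y v = (lam - 2) \<odot>\<^bsub>V\<^esub> v"
      using v by (intro vec_eqI) (auto simp: sum4_ip algebra_simps)
  qed
  show ?thesis using offset_values[OF nonzero] by auto
qed

lemma Lambda_bd_on_4_subset:
  "Lambda_bd_on TYPE('v) 4 \<subseteq>
     {2 + 2 / of_nat k | k :: nat. k \<ge> 1} \<union> {2 - 2 / of_nat k | k :: nat. k \<ge> 1} \<union> {2}"
proof
  fix lam assume "lam \<in> Lambda_bd_on TYPE('v) 4"
  then obtain V :: "(complex, 'v) module" and ip Q where
    V: "separable_hilbert_space V ip" "carrier V \<noteq> {\<zero>\<^bsub>V\<^esub>}"
    and Q: "\<And>k. k \<in> {1..4} \<Longrightarrow> Q k \<in> complex_inner_product_space.bounded_operators V ip"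
      "\<And>k v. \<lbrakk>k \<in> {1..4::nat}; v \<in> carrier V\<rbrakk> \<Longrightarrow> Q k (Q k v) = Q k v"
      "\<And>v. v \<in> carrier V \<Longrightarrow> (\<Oplus>\<^bsub>V\<^esub>k \<in> {1..4}. Q k v) = lam \<odot>\<^bsub>V\<^esub> v"
    unfolding Lambda_bd_on_def by blast
  interpret separable_hilbert_space V ip by fact
  have "lam = 2 \<or> (\<exists>k \<ge> 1. \<exists>\<epsilon> \<in> {1, -1}. of_nat k * (lam - 2) = 2 * \<epsilon>)"
    by (rule sum_of_four_idempotents_values[OF Q V(2)])
  thus "lam \<in> {2 + 2 / of_nat k | k :: nat. k \<ge> 1} \<union> {2 - 2 / of_nat k | k :: nat. k \<ge> 1} \<union> {2}"
  proof (elim disjE exE conjE bexE)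
    fix k :: nat and \<epsilon> :: complex
    assume k: "k \<ge> 1" and \<epsilon>: "\<epsilon> \<in> {1, -1}" and eq: "of_nat k * (lam - 2) = 2 * \<epsilon>"
    have "lam = 2 + 2 * \<epsilon> / of_nat k" using k eq by (simp add: field_simps)
    thus ?thesis using k \<epsilon> by auto
  qed simp
qed

section \<open>Finite-dimensional spaces as Hilbert spaces\<close>

text \<open>A finite-dimensional space with a fixed basis \<open>A\<close>, where \<open>\<phi> x b\<close> is the coordinate of \<open>x\<close> at the
  basis vector \<open>b\<close>; the coordinates carry the standard inner product over to the space.\<close>

locale coordinates = vectorspace "class_ring :: complex ring" V
  for V :: "(complex, 'v) module" (structure) +
  fixes A :: "'v set" and \<phi> :: "'v \<Rightarrow> 'v \<Rightarrow> complex"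
  assumes finite_A: "finite A" and A_carrier: "A \<subseteq> carrier V"
    and lincomb_\<phi>: "x \<in> carrier V \<Longrightarrow> lincomb (\<phi> x) A = x"
    and \<phi>_lincomb: "b \<in> A \<Longrightarrow> \<phi> (lincomb a A) b = a b"
begin

lemma lincomb_carrier: "lincomb a A \<in> carrier V"
  using A_carrier by (intro lincomb_closed) auto

lemma \<phi>_add:
  assumes "x \<in> carrier V" "y \<in> carrier V" "b \<in> A"
  shows "\<phi> (x \<oplus> y) b = \<phi> x b + \<phi> y b"
proof -
  have "lincomb (\<lambda>v. \<phi> x v + \<phi> y v) A = lincomb (\<phi> x) A \<oplus> lincomb (\<phi> y) A"
    using lincomb_sum[OF finite_A A_carrier, of "\<phi> x" "\<phi> y"] by simp
  also have "\<dots> = x \<oplus> y" by (simp only: lincomb_\<phi> assms)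
  finally show ?thesis using \<phi>_lincomb[OF assms(3)] by metis
qed

lemma \<phi>_smult:
  assumes "x \<in> carrier V" "b \<in> A"
  shows "\<phi> (c \<odot>\<^bsub>V\<^esub> x) b = c * \<phi> x b"
proof -
  have "lincomb (\<lambda>v. c * \<phi> x v) A = c \<odot>\<^bsub>V\<^esub> lincomb (\<phi> x) A"
    using lincomb_smult[OF A_carrier, of "\<phi> x" c] by simp
  also have "\<dots> = c \<odot>\<^bsub>V\<^esub> x" by (simp only: lincomb_\<phi> assms)
  finally show ?thesis using \<phi>_lincomb[OF assms(2)] by metis
qed

definition coord_ip :: "'v \<Rightarrow> 'v \<Rightarrow> complex" where
  "coord_ip x y = (\<Sum>b\<in>A. \<phi> x b * cnj (\<phi> y b))"

lemma Re_coord_ip_self: "Re (coord_ip x x) = (\<Sum>b\<in>A. (cmod (\<phi> x b))\<^sup>2)"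
  by (simp add: coord_ip_def complex_norm_square[symmetric] flip: of_real_power)

sublocale H: complex_inner_product_space V coord_ip
proof
  fix x y z c
  assume x: "x \<in> carrier V"
  show "coord_ip (c \<odot>\<^bsub>V\<^esub> x) y = c * coord_ip x y" if "y \<in> carrier V"
    using x that by (simp add: coord_ip_def \<phi>_smult sum_distrib_left mult.assoc)
  show "coord_ip y x = cnj (coord_ip x y)" if "y \<in> carrier V"
    by (simp add: coord_ip_def mult.commute)
  show "coord_ip (x \<oplus> y) z = coord_ip x z + coord_ip y z" if "y \<in> carrier V" "z \<in> carrier V"
    using x that by (simp add: coord_ip_def \<phi>_add sum.distrib algebra_simps)
  assume "x \<noteq> \<zero>"
  have "\<exists>b\<in>A. \<phi> x b \<noteq> 0"
  proof (rule ccontr)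
    assume "\<not> ?thesis"
    hence "lincomb (\<phi> x) A = (\<Oplus>v\<in>A. \<zero>)"
      unfolding lincomb_def using A_carrier by (intro M.finsum_cong') (auto simp: smult_l_null[simplified])
    thus False using lincomb_\<phi>[OF x] \<open>x \<noteq> \<zero>\<close> by simp
  qed
  thus "0 < Re (coord_ip x x)"
    unfolding Re_coord_ip_self using finite_A by (auto intro: sum_pos2)
qed

lemma nrm_eq_L2_set: "H.nrm x = L2_set (\<lambda>b. cmod (\<phi> x b)) A"
  by (simp add: H.nrm_def Re_coord_ip_self L2_set_def)

lemma \<phi>_minus:
  assumes "x \<in> carrier V" "y \<in> carrier V" "b \<in> A"
  shows "\<phi> (x \<ominus> y) b = \<phi> x b - \<phi> y b"
proof -
  have "\<phi> ((x \<ominus> y) \<oplus> y) b = \<phi> (x \<ominus> y) b + \<phi> y b" using assms by (intro \<phi>_add) auto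
  moreover have "(x \<ominus> y) \<oplus> y = x" using assms by (simp add: a_minus_def M.a_assoc M.l_neg)
  ultimately show ?thesis by simp
qed

lemma cmod_\<phi>_le_dst:
  assumes "x \<in> carrier V" "y \<in> carrier V" "b \<in> A"
  shows "cmod (\<phi> x b - \<phi> y b) \<le> H.dst x y"
  using assms member_le_L2_set[OF finite_A, of b "\<lambda>b. cmod (\<phi> (x \<ominus> y) b)"]
  by (simp add: H.dst_def nrm_eq_L2_set \<phi>_minus)

lemma dst_le_sum:
  assumes "x \<in> carrier V" "y \<in> carrier V"
  shows "H.dst x y \<le> (\<Sum>b\<in>A. cmod (\<phi> x b - \<phi> y b))"
proof -
  have "H.dst x y \<le> (\<Sum>b\<in>A. cmod (\<phi> (x \<ominus> y) b))"
    using assms L2_set_le_sum[of A "\<lambda>b. cmod (\<phi> (x \<ominus> y) b)"] by (simp add: H.dst_def nrm_eq_L2_set)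
  thus ?thesis using assms by (simp add: \<phi>_minus)
qed

lemma operator_bounded:
  assumes T: "T \<in> endomorphisms V"
  shows "T \<in> H.bounded_operators"
proof -
  note [simp] = H.operatorD[OF T]
  \<comment> \<open>The default for an empty linear combination is the zero vector, so the base case needs \<open>T 0 = 0\<close>.\<close>
  have T0: "T \<zero> = \<zero>"
  proof (rule H.vec_eqI)
    fix z assume "z \<in> carrier V"
    thus "coord_ip (T \<zero>) z = coord_ip \<zero> z"
      using H.operatorD(3)[OF T, of \<zero> 0] H.ip_smult_left[of "T \<zero>" z 0] by simp
  qed auto
  have bound: "nrmT \<le> (\<Sum>b\<in>B. cmod (a b) * H.nrm (T b))"
    if "finite B" "B \<subseteq> carrier V" "nrmT = H.nrm (T (lincomb a B))" for a B nrmT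
    using that
  proof (induction B arbitrary: nrmT rule: finite_induct)
    case empty
    thus ?case by (simp add: lincomb_def T0 H.nrm_def)
  next
    case (insert b B)
    have cl: "lincomb a B \<in> carrier V" "b \<in> carrier V" using insert by (auto intro!: lincomb_closed)
    have "lincomb a (insert b B) = a b \<odot>\<^bsub>V\<^esub> b \<oplus> lincomb a B"
      unfolding lincomb_def using insert cl by (subst M.finsum_insert) auto
    hence "H.nrm (T (lincomb a (insert b B))) \<le> H.nrm (a b \<odot>\<^bsub>V\<^esub> T b) + H.nrm (T (lincomb a B))"
      using cl H.nrm_triangle[of "a b \<odot>\<^bsub>V\<^esub> T b" "T (lincomb a B)"] by simp
    thus ?case using insert.IH[OF _ refl] insert.hyps insert.prems cl by (simp add: H.nrm_smult)
  qed
  have "H.nrm (T x) \<le> (\<Sum>b\<in>A. H.nrm (T b)) * H.nrm x" if x: "x \<in> carrier V" for x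
  proof -
    have "H.nrm (T x) \<le> (\<Sum>b\<in>A. cmod (\<phi> x b) * H.nrm (T b))"
      by (rule bound[OF finite_A A_carrier]) (simp add: lincomb_\<phi>[OF x])
    also have "\<dots> \<le> (\<Sum>b\<in>A. H.nrm x * H.nrm (T b))"
      using A_carrier finite_A
      by (intro sum_mono mult_right_mono H.nrm_nonneg)
         (auto simp: nrm_eq_L2_set member_le_L2_set[of A _ "\<lambda>b. cmod (\<phi> x b)"])
    finally show ?thesis by (simp add: sum_distrib_left mult.commute)
  qed
  thus ?thesis using T by (auto simp: H.bounded_operators_def)
qed

lemma coordinates_complete: "H.metric.mcomplete"
  unfolding H.metric.mcomplete_def
proof (intro allI impI)
  fix s assume s: "H.metric.MCauchy s"
  hence sV: "s n \<in> carrier V" for n unfolding H.metric.MCauchy_def by auto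
  have "\<exists>l. (\<lambda>n. \<phi> (s n) b) \<longlonglongrightarrow> l" if b: "b \<in> A" for b
  proof -
    have "Cauchy (\<lambda>n. \<phi> (s n) b)"
    proof (rule CauchyI)
      fix e :: real assume "e > 0"
      then obtain N where N: "\<And>n m. \<lbrakk>n \<ge> N; m \<ge> N\<rbrakk> \<Longrightarrow> H.dst (s n) (s m) < e"
        using s unfolding H.metric.MCauchy_def by blast
      have "cmod (\<phi> (s n) b - \<phi> (s m) b) < e" if "n \<ge> N" "m \<ge> N" for n m
        using N[OF that] cmod_\<phi>_le_dst[OF sV[of n] sV[of m] b] by simp
      thus "\<exists>M. \<forall>n\<ge>M. \<forall>m\<ge>M. norm (\<phi> (s n) b - \<phi> (s m) b) < e" by blast
    qed
    thus ?thesis using Cauchy_convergent_iff convergent_def by blast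
  qed
  then obtain l where l: "\<And>b. b \<in> A \<Longrightarrow> (\<lambda>n. \<phi> (s n) b) \<longlonglongrightarrow> l b" by metis
  define x where "x = lincomb l A"
  have xV: "x \<in> carrier V" by (simp add: x_def lincomb_carrier)
  have "(\<lambda>n. \<Sum>b\<in>A. cmod (\<phi> (s n) b - l b)) \<longlonglongrightarrow> (\<Sum>b\<in>A. cmod (l b - l b))"
    using l by (intro tendsto_sum tendsto_norm tendsto_diff) auto
  hence lim: "(\<lambda>n. \<Sum>b\<in>A. cmod (\<phi> (s n) b - l b)) \<longlonglongrightarrow> 0" by simp
  have "limitin H.metric.mtopology s x sequentially"
    unfolding H.metric.limitin_metric
  proof (intro conjI allI impI xV)
    fix e :: real assume "e > 0"
    hence "\<forall>\<^sub>F n in sequentially. (\<Sum>b\<in>A. cmod (\<phi> (s n) b - l b)) < e"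
      using order_tendstoD(2)[OF lim] by blast
    thus "\<forall>\<^sub>F n in sequentially. s n \<in> carrier V \<and> H.dst (s n) x < e"
    proof eventually_elim
      case (elim n)
      have "H.dst (s n) x \<le> (\<Sum>b\<in>A. cmod (\<phi> (s n) b - l b))"
        using dst_le_sum[OF sV[of n] xV] by (simp add: x_def \<phi>_lincomb)
      thus ?case using elim sV by simp
    qed
  qed
  thus "\<exists>x. limitin H.metric.mtopology s x sequentially" ..
qed

lemma coordinates_separable: "separable_space H.metric.mtopology"
proof -
  obtain D :: "complex set" where D: "countable D"
    and dense: "\<And>U. open U \<Longrightarrow> U \<noteq> {} \<Longrightarrow> \<exists>d\<in>D. d \<in> U"
    using countable_dense_setE by blast
  define S where "S = (\<lambda>a. lincomb a A) ` (A \<rightarrow>\<^sub>E D)"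
  have "countable S"
    unfolding S_def using finite_A D by (intro countable_image countable_PiE) auto
  moreover have S: "S \<subseteq> carrier V" by (auto simp: S_def lincomb_carrier)
  moreover have "x \<in> H.metric.mtopology closure_of S" if x: "x \<in> carrier V" for x
    unfolding H.metric.metric_closure_of
  proof (intro CollectI conjI x allI impI)
    fix r :: real assume r: "r > 0"
    define \<delta> where "\<delta> = r / (real (card A) + 1)"
    have \<delta>: "\<delta> > 0" using r by (simp add: \<delta>_def)
    hence "\<forall>b. \<exists>d\<in>D. d \<in> ball (\<phi> x b) \<delta>" by (intro allI dense) auto
    then obtain d where d: "\<And>b. d b \<in> D" "\<And>b. d b \<in> ball (\<phi> x b) \<delta>" by metis
    define y where "y = lincomb (restrict d A) A"
    have yS: "y \<in> S" using d(1) by (auto simp: y_def S_def)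
    hence yV: "y \<in> carrier V" using S by auto
    have "H.dst x y \<le> (\<Sum>b\<in>A. cmod (\<phi> x b - \<phi> y b))" by (rule dst_le_sum[OF x yV])
    also have "\<dots> \<le> real (card A) * \<delta>"
      using d(2) by (intro sum_bounded_above) (auto simp: y_def \<phi>_lincomb dist_norm less_imp_le)
    also have "\<dots> < r" using r by (simp add: \<delta>_def field_simps)
    finally show "\<exists>y\<in>S. y \<in> H.metric.mball x r"
      using x yV yS by (auto simp: H.metric.in_mball)
  qed
  hence "H.metric.mtopology closure_of S = carrier V"
    using closure_of_subset_topspace[of H.metric.mtopology S] by auto
  ultimately show ?thesis by (auto simp: separable_space_def)
qed

lemma coordinates_hilbert: "separable_hilbert_space V coord_ip"
  by unfold_locales (rule coordinates_complete coordinates_separable)+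

end

lemma coordinates_exist:
  fixes V :: "(complex, 'v) module" (structure)
  assumes "vectorspace class_ring V" "vectorspace.fin_dim class_ring V"
  obtains A \<phi> where "coordinates V A \<phi>"
proof -
  interpret vectorspace "class_ring :: complex ring" V by fact
  obtain A where A: "finite A" "basis A" using finite_basis_exists[OF assms(2)] by blast
  hence A_carrier: "A \<subseteq> carrier V" by (simp add: basis_def)
  hence uniq: "\<exists>!a. a \<in> A \<rightarrow>\<^sub>E UNIV \<and> lincomb a A = v" if "v \<in> carrier V" for v
    using iffD1[OF basis_criterion[OF A(1) A_carrier] A(2), rule_format, OF that] by simp
  define \<phi> where "\<phi> v = (THE a. a \<in> A \<rightarrow>\<^sub>E UNIV \<and> lincomb a A = v)" for v
  have \<phi>: "\<phi> v \<in> A \<rightarrow>\<^sub>E UNIV \<and> lincomb (\<phi> v) A = v" if "v \<in> carrier V" for v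
    unfolding \<phi>_def by (rule theI'[OF uniq[OF that]])
  have "\<phi> (lincomb a A) b = a b" if "b \<in> A" for a b
  proof -
    have cl: "lincomb a A \<in> carrier V" using A_carrier by (intro lincomb_closed) auto
    have "lincomb (restrict a A) A = lincomb a A"
      unfolding lincomb_def using A_carrier by (intro M.finsum_cong') auto
    hence "\<phi> (lincomb a A) = restrict a A"
      unfolding \<phi>_def by (intro the1_equality[OF uniq[OF cl]]) auto
    thus ?thesis using that by simp
  qed
  thus ?thesis
    using A(1) A_carrier \<phi> vectorspace_axioms
    by (intro that[of A \<phi>] coordinates.intro coordinates_axioms.intro) auto
qed

section \<open>The quotient of the free algebra by the relations\<close>

lemma free_algebra_simps:
  "mult (free_algebra n) = (*)" "one (free_algebra n) = 1" "zero (free_algebra n) = 0"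
  "add (free_algebra n) = (+)" "smult (free_algebra n) = (\<lambda>c p. const c * p)"
  by (simp_all add: free_algebra_def)

lemma gen_carrier: "k \<in> {1..n} \<Longrightarrow> gen k \<in> carrier (free_algebra n)"
  by (auto simp: gen_def free_algebra_def)

lemma const_carrier: "const c \<in> carrier (free_algebra n)"
  by (auto simp: const_def free_algebra_def zero_free_word_def)

lemma free_algebra_minus:
  assumes "p \<in> carrier (free_algebra n)" "q \<in> carrier (free_algebra n)"
  shows "p \<ominus>\<^bsub>free_algebra n\<^esub> q = p - q"
proof -
  interpret ring "free_algebra n" by (rule free_algebra_ring)
  have "- q \<in> carrier (free_algebra n)" using assms(2) by (simp add: free_algebra_def)
  hence "\<ominus>\<^bsub>free_algebra n\<^esub> q = - q"
    using assms(2) by (intro minus_equality) (simp_all add: free_algebra_simps)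
  thus ?thesis by (simp add: a_minus_def free_algebra_simps)
qed

definition relation_ideal :: "nat \<Rightarrow> complex \<Rightarrow> nc_poly set" where
  "relation_ideal n lam = Idl\<^bsub>free_algebra n\<^esub> (relators n lam)"

definition residue_class :: "nat \<Rightarrow> complex \<Rightarrow> nc_poly \<Rightarrow> nc_poly set" where
  "residue_class n lam p = relation_ideal n lam +>\<^bsub>free_algebra n\<^esub> p"

lemma relation_ideal: "ideal (relation_ideal n lam) (free_algebra n)"
  unfolding relation_ideal_def by (rule ring.genideal_ideal[OF free_algebra_ring relators_subset])

lemma residue_class_eq_iff:
  assumes "p \<in> carrier (free_algebra n)" "q \<in> carrier (free_algebra n)"
  shows "residue_class n lam p = residue_class n lam q \<longleftrightarrow> p - q \<in> relation_ideal n lam"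
  using ring.quotient_eq_iff_same_a_r_cos[OF free_algebra_ring relation_ideal assms]
  by (simp add: residue_class_def free_algebra_minus assms)

lemma carrier_Q_algebra:
  "carrier (Q_algebra n lam) = residue_class n lam ` carrier (free_algebra n)"
  by (auto simp: Q_algebra_def quotient_algebra_def FactRing_def A_RCOSETS_def' residue_class_def
      relation_ideal_def)

lemma residue_class_simps:
  assumes "p \<in> carrier (free_algebra n)" "q \<in> carrier (free_algebra n)"
  shows "residue_class n lam p \<oplus>\<^bsub>Q_algebra n lam\<^esub> residue_class n lam q = residue_class n lam (p + q)"
    and "residue_class n lam p \<otimes>\<^bsub>Q_algebra n lam\<^esub> residue_class n lam q = residue_class n lam (p * q)"
    and "c \<odot>\<^bsub>Q_algebra n lam\<^esub> residue_class n lam p = residue_class n lam (const c * p)"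
  using ideal.a_rcos_sum[OF relation_ideal[of n lam] assms]
    ideal.rcoset_mult_add[OF relation_ideal[of n lam] assms]
    ideal.rcoset_mult_add[OF relation_ideal[of n lam] const_carrier[of c] assms(1)]
  by (simp_all add: Q_algebra_def quotient_algebra_def FactRing_def residue_class_def
      relation_ideal_def free_algebra_simps)

lemma residue_class_one: "\<one>\<^bsub>Q_algebra n lam\<^esub> = residue_class n lam 1"
  by (simp add: Q_algebra_def quotient_algebra_def FactRing_def residue_class_def
      relation_ideal_def free_algebra_simps)

lemma relators_in_relation_ideal: "relators n lam \<subseteq> relation_ideal n lam"
  unfolding relation_ideal_def by (rule ring.genideal_self[OF free_algebra_ring relators_subset])

lemma free_algebra_closed:
  shows "\<lbrakk>p \<in> carrier (free_algebra n); q \<in> carrier (free_algebra n)\<rbrakk> \<Longrightarrow> p + q \<in> carrier (free_algebra n)"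
    and "\<lbrakk>p \<in> carrier (free_algebra n); q \<in> carrier (free_algebra n)\<rbrakk> \<Longrightarrow> p * q \<in> carrier (free_algebra n)"
    and "0 \<in> carrier (free_algebra n)" "1 \<in> carrier (free_algebra n)"
proof -
  interpret ring "free_algebra n" by (rule free_algebra_ring)
  show "\<lbrakk>p \<in> carrier (free_algebra n); q \<in> carrier (free_algebra n)\<rbrakk> \<Longrightarrow> p + q \<in> carrier (free_algebra n)"
    and "\<lbrakk>p \<in> carrier (free_algebra n); q \<in> carrier (free_algebra n)\<rbrakk> \<Longrightarrow> p * q \<in> carrier (free_algebra n)"
    and "0 \<in> carrier (free_algebra n)" "1 \<in> carrier (free_algebra n)"
    using a_closed[of p q] m_closed[of p q] zero_closed one_closed by (simp_all add: free_algebra_simps)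
qed

lemma sum_gen_carrier:
  assumes "K \<subseteq> {1..n}"
  shows "sum gen K \<in> carrier (free_algebra n)"
proof -
  have "finite K" using assms finite_subset by blast
  thus ?thesis using assms
    by (induction K rule: finite_induct) (auto simp: free_algebra_closed gen_carrier)
qed

text \<open>Cosets of the relators vanish in the quotient, so the images of the generators satisfy the
  defining relations literally.\<close>

lemma representation_generators:
  assumes V: "vectorspace class_ring V" and \<pi>: "representation (Q_algebra n lam) V \<pi>"
  defines "Q \<equiv> \<lambda>k. \<pi> (residue_class n lam (gen k))"
  shows "k \<in> {1..n} \<Longrightarrow> Q k \<in> endomorphisms V"
    and "\<lbrakk>k \<in> {1..n}; v \<in> carrier V\<rbrakk> \<Longrightarrow> Q k (Q k v) = Q k v"
    and "v \<in> carrier V \<Longrightarrow> (\<Oplus>\<^bsub>V\<^esub>k \<in> {1..n}. Q k v) = lam \<odot>\<^bsub>V\<^esub> v"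
proof -
  interpret vectorspace "class_ring :: complex ring" V by (rule V)
  let ?F = "free_algebra n" and ?r = "residue_class n lam"
  have r: "?r p \<in> carrier (Q_algebra n lam)" if "p \<in> carrier ?F" for p
    using that by (simp add: carrier_Q_algebra)
  have endo_\<pi>: "\<pi> (?r p) \<in> endomorphisms V" if "p \<in> carrier ?F" for p
    using \<pi> r[OF that] by (simp add: representation_def)
  have one_\<pi>: "\<pi> (?r 1) v = v" if "v \<in> carrier V" for v
    using \<pi> that by (simp add: representation_def residue_class_one)
  have hom_\<pi>: "\<pi> (?r (p + q)) v = \<pi> (?r p) v \<oplus>\<^bsub>V\<^esub> \<pi> (?r q) v"
      "\<pi> (?r (p * q)) v = \<pi> (?r p) (\<pi> (?r q) v)"
      "\<pi> (?r (const c * p)) v = c \<odot>\<^bsub>V\<^esub> \<pi> (?r p) v"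
    if "p \<in> carrier ?F" "q \<in> carrier ?F" "v \<in> carrier V" for p q v c
    using \<pi> that r[OF that(1)] r[OF that(2)]
    by (simp_all add: representation_def flip: residue_class_simps)
  have rel: "\<pi> (?r p) = \<pi> (?r q)" if "p \<in> carrier ?F" "q \<in> carrier ?F" "p - q \<in> relators n lam" for p q
  proof -
    have "?r p = ?r q"
      using residue_class_eq_iff[OF that(1,2)] relators_in_relation_ideal that(3) by blast
    thus ?thesis by simp
  qed
  show endo: "k \<in> {1..n} \<Longrightarrow> Q k \<in> endomorphisms V" for k
    unfolding Q_def by (intro endo_\<pi> gen_carrier)
  show "Q k (Q k v) = Q k v" if "k \<in> {1..n}" "v \<in> carrier V"
  proof -
    have "gen k * gen k - gen k \<in> relators n lam"
      using that(1) by (auto simp: relators_def power2_eq_square)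
    thus ?thesis
      using rel[of "gen k * gen k" "gen k"] hom_\<pi>(2)[of "gen k" "gen k" v] that
      by (simp add: Q_def gen_carrier free_algebra_closed)
  qed
  show "(\<Oplus>\<^bsub>V\<^esub>k \<in> {1..n}. Q k v) = lam \<odot>\<^bsub>V\<^esub> v" if v: "v \<in> carrier V"
  proof -
    have Qv: "Q k v \<in> carrier V" if "k \<in> {1..n}" for k
      using endo[OF that] v by (auto simp: endomorphisms_def module_hom_def)
    have sum: "\<pi> (?r (sum gen K)) v = (\<Oplus>\<^bsub>V\<^esub>k \<in> K. Q k v)" if "K \<subseteq> {1..n}" for K
      using finite_subset[OF that finite_atLeastAtMost] that
    proof (induction K rule: finite_induct)
      case empty
      have "\<pi> (?r (const 0 * 0)) v = 0 \<odot>\<^bsub>V\<^esub> \<pi> (?r 0) v"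
        using v by (intro hom_\<pi>(3)[of 0 0]) (auto simp: free_algebra_closed)
      moreover have "\<pi> (?r 0) v \<in> carrier V"
        using endo_\<pi>[of 0] v free_algebra_closed(3)[of n] by (auto simp: endomorphisms_def module_hom_def)
      ultimately show ?case by (simp add: smult_l_null[simplified])
    next
      case (insert k K)
      have "\<pi> (?r (gen k + sum gen K)) v = Q k v \<oplus>\<^bsub>V\<^esub> \<pi> (?r (sum gen K)) v"
        unfolding Q_def using insert.prems v by (intro hom_\<pi>(1) gen_carrier sum_gen_carrier) auto
      also have "\<dots> = Q k v \<oplus>\<^bsub>V\<^esub> (\<Oplus>\<^bsub>V\<^esub>k \<in> K. Q k v)" using insert by simp
      finally show ?case
        using insert.hyps insert.prems Qv by (subst M.finsum_insert) auto
    qed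
    have "\<pi> (?r (sum gen {1..n})) v = \<pi> (?r (const lam * 1)) v"
      by (subst rel[of "sum gen {1..n}" "const lam * 1"])
         (auto simp: sum_gen_carrier const_carrier relators_def)
    also have "\<dots> = lam \<odot>\<^bsub>V\<^esub> v"
      using hom_\<pi>(3)[of 1 1 v lam] one_\<pi>[of v] v by (simp add: free_algebra_closed)
    finally show ?thesis using sum by simp
  qed
qed

lemma Lambda_fd_on_subset_bd: "Lambda_fd_on TYPE('v) n \<subseteq> Lambda_bd_on TYPE('v) n"
proof
  fix lam assume "lam \<in> Lambda_fd_on TYPE('v) n"
  then obtain V :: "(complex, 'v) module" and \<pi> where
    V: "vectorspace class_ring V" "vectorspace.fin_dim class_ring V" "carrier V \<noteq> {\<zero>\<^bsub>V\<^esub>}"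
    and \<pi>: "representation (Q_algebra n lam) V \<pi>"
    by (auto simp: Lambda_fd_on_def)
  obtain A \<phi> where "coordinates V A \<phi>" using coordinates_exist[OF V(1,2)] .
  then interpret coordinates V A \<phi> .
  note Q = representation_generators[OF V(1) \<pi>]
  show "lam \<in> Lambda_bd_on TYPE('v) n"
    unfolding Lambda_bd_on_def
  proof (intro CollectI exI conjI ballI)
    show "separable_hilbert_space V coord_ip" by (rule coordinates_hilbert)
  qed (use V(3) Q operator_bounded in blast)+
qed

section \<open>Representations from operators on sequences\<close>

text \<open>Operators on all sequences make every vector identity a pointwise identity of complex numbers.
  Finite dimension comes in later, through an invariant subspace of finitely supported sequences.\<close>

definition linear_operator :: "((nat \<Rightarrow> complex) \<Rightarrow> nat \<Rightarrow> complex) \<Rightarrow> bool" where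
  "linear_operator T \<longleftrightarrow> (\<forall>f g a b. T (\<lambda>i. a * f i + b * g i) = (\<lambda>i. a * T f i + b * T g i))"

lemma linear_operatorD: "linear_operator T \<Longrightarrow> T (\<lambda>i. a * f i + b * g i) = (\<lambda>i. a * T f i + b * T g i)"
  by (simp add: linear_operator_def)

lemma linear_operator_add: "linear_operator T \<Longrightarrow> T (\<lambda>i. f i + g i) = (\<lambda>i. T f i + T g i)"
  using linear_operatorD[of T 1 f 1 g] by simp

lemma linear_operator_scale: "linear_operator T \<Longrightarrow> T (\<lambda>i. a * f i) = (\<lambda>i. a * T f i)"
  using linear_operatorD[of T a f 0 f] by simp

lemma linear_operator_foldr:
  assumes "\<And>k. linear_operator (Q k)"
  shows "linear_operator (foldr Q ks)"
proof (induction ks)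
  case (Cons k ks)
  thus ?case using assms[of k] by (simp add: linear_operator_def)
qed (simp add: linear_operator_def)

text \<open>The algebra homomorphism from the free algebra to operators determined by \<open>gen k \<mapsto> Q k\<close>.\<close>

definition act :: "(nat \<Rightarrow> (nat \<Rightarrow> complex) \<Rightarrow> nat \<Rightarrow> complex) \<Rightarrow> nc_poly \<Rightarrow> (nat \<Rightarrow> complex) \<Rightarrow> nat \<Rightarrow> complex"
  where "act Q p f i = (\<Sum>w\<in>Poly_Mapping.keys p. Poly_Mapping.lookup p w * foldr Q (letters w) f i)"

lemma act_single: "act Q (Poly_Mapping.single w c) f = (\<lambda>i. c * foldr Q (letters w) f i)"
  by (auto simp: act_def fun_eq_iff)

lemma act_add: "act Q (p + q) f = (\<lambda>i. act Q p f i + act Q q f i)"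
proof
  fix i
  let ?K = "Poly_Mapping.keys p \<union> Poly_Mapping.keys q"
  have act: "act Q r f i = (\<Sum>w\<in>?K. Poly_Mapping.lookup r w * foldr Q (letters w) f i)"
    if "Poly_Mapping.keys r \<subseteq> ?K" for r
    unfolding act_def using that by (intro sum.mono_neutral_left) (auto simp: in_keys_iff)
  show "act Q (p + q) f i = act Q p f i + act Q q f i"
    using Poly_Mapping.keys_add[of p q]
    by (simp add: act lookup_add sum.distrib algebra_simps)
qed

lemma poly_mapping_sum_induct [case_names zero single add]:
  assumes "P 0" and "\<And>w c. P (Poly_Mapping.single w c)" and add: "\<And>p q. P p \<Longrightarrow> P q \<Longrightarrow> P (p + q)"
  shows "P p"
proof (induction p rule: update_induct)
  case const
  show ?case by fact
next
  case (update p w c)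
  have "Poly_Mapping.update w c p = Poly_Mapping.single w c + p"
    using update.hyps by (intro poly_mapping_eqI) (auto simp: lookup_update lookup_add lookup_single in_keys_iff)
  thus ?case using add[OF assms(2) update.IH] by simp
qed

context
  fixes Q :: "nat \<Rightarrow> (nat \<Rightarrow> complex) \<Rightarrow> nat \<Rightarrow> complex"
  assumes linear: "\<And>k. linear_operator (Q k)"
begin

lemma act_zero: "act Q 0 f = (\<lambda>i. 0)"
  by (simp add: act_def fun_eq_iff)

lemma act_linear: "linear_operator (act Q p)"
  unfolding linear_operator_def
  using linear_operatorD[OF linear_operator_foldr, of Q, OF linear]
  by (auto simp: act_def fun_eq_iff sum_distrib_left sum.distrib algebra_simps)

lemma act_mult: "act Q (p * q) f = act Q p (act Q q f)"
proof (induction p rule: poly_mapping_sum_induct)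
  case (single u c)
  show ?case
  proof (induction q rule: poly_mapping_sum_induct)
    case zero
    show ?case
      using linear_operator_scale[OF act_linear, of "Poly_Mapping.single u c" 0 "\<lambda>i. 0"] by (simp add: act_zero)
  next
    case (single v d)
    show ?case
      using linear_operator_scale[OF linear_operator_foldr, of Q, OF linear]
      by (simp add: mult_single act_single plus_free_word_def mult.assoc)
  next
    case (add q r)
    thus ?case by (simp add: distrib_left act_add linear_operator_add[OF act_linear])
  qed
qed (simp_all add: act_zero act_add distrib_right)

lemma act_gen: "act Q (gen k) f = Q k f"
  by (simp add: gen_def act_single)

lemma act_const: "act Q (const c) f = (\<lambda>i. c * f i)"
  by (simp add: const_def act_single zero_free_word_def)

lemma act_one: "act Q 1 f = f"
  using act_const[of 1 f] by (simp add: const_def)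

lemma act_diff: "act Q (p - q) f = (\<lambda>i. act Q p f i - act Q q f i)"
  using act_add[of Q "p - q" q f] by (simp add: fun_eq_iff)

lemma act_minus: "act Q (- p) f = (\<lambda>i. - act Q p f i)"
  using act_diff[of 0 p f] by (simp add: act_zero)

lemma act_sum_gen: "finite K \<Longrightarrow> act Q (sum gen K) f = (\<lambda>i. \<Sum>k\<in>K. Q k f i)"
  by (induction K rule: finite_induct) (simp_all add: act_zero act_add act_gen)

text \<open>The elements that act as zero form an ideal of the free algebra; once it contains the relators, it
  contains the ideal they generate.\<close>

lemma relation_ideal_acts_trivially:
  assumes idem: "\<And>k f. k \<in> {1..n} \<Longrightarrow> Q k (Q k f) = Q k f"
    and sum: "\<And>f i. (\<Sum>k = 1..n. Q k f i) = lam * f i"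
    and p: "p \<in> relation_ideal n lam"
  shows "act Q p f = (\<lambda>i. 0)"
proof -
  interpret ring "free_algebra n" by (rule free_algebra_ring)
  define J where "J = {p \<in> carrier (free_algebra n). \<forall>f. act Q p f = (\<lambda>i. 0)}"
  have act0: "act Q p (\<lambda>i. 0) = (\<lambda>i. 0)" for p
    using linear_operator_scale[OF act_linear, of p 0 "\<lambda>i. 0"] by simp
  have neg: "\<ominus>\<^bsub>free_algebra n\<^esub> p = - p" if "p \<in> carrier (free_algebra n)" for p
    using free_algebra_minus[OF zero_closed that] that by (simp add: a_minus_def free_algebra_simps)
  have "ideal J (free_algebra n)"
  proof (rule idealI[OF free_algebra_ring])
    show "subgroup J (add_monoid (free_algebra n))"
    proof (rule group.subgroupI)
      show "group (add_monoid (free_algebra n))" by (rule a_group)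
      have "0 \<in> J" by (simp add: J_def free_algebra_closed act_zero)
      thus "J \<noteq> {}" by auto
      fix p assume p: "p \<in> J"
      have "\<ominus>\<^bsub>free_algebra n\<^esub> p \<in> J"
        using p a_inv_closed[of p] by (auto simp: J_def neg act_minus)
      thus "inv\<^bsub>add_monoid (free_algebra n)\<^esub> p \<in> J" by (simp add: a_inv_def)
      fix q assume "q \<in> J"
      thus "p \<otimes>\<^bsub>add_monoid (free_algebra n)\<^esub> q \<in> J"
        using p by (simp add: J_def free_algebra_simps free_algebra_closed act_add)
    qed (auto simp: J_def)
  qed (auto simp: J_def free_algebra_simps free_algebra_closed act_mult act0)
  moreover have "relators n lam \<subseteq> J"
    using relators_subset[of n lam] idem sum
    by (auto simp: J_def relators_def act_diff act_mult act_gen act_const power2_eq_square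
        act_sum_gen fun_eq_iff)
  ultimately have "relation_ideal n lam \<subseteq> J"
    unfolding relation_ideal_def by (rule genideal_minimal)
  thus ?thesis using p by (auto simp: J_def)
qed

text \<open>The sequences supported below \<open>m\<close> are identified with \<open>\<complex>\<^sup>m\<close>: \<open>ext\<close> extends a vector by zeros, and the
  support hypothesis says that nothing is lost when a result is truncated back to length \<open>m\<close>.\<close>

lemma Lambda_fd_of_operators:
  assumes support: "\<And>k f. (\<And>i. i \<ge> m \<Longrightarrow> f i = 0) \<Longrightarrow> (\<And>i. i \<ge> m \<Longrightarrow> Q k f i = 0)"
    and idem: "\<And>k f. k \<in> {1..n} \<Longrightarrow> Q k (Q k f) = Q k f"
    and sum: "\<And>f i. (\<Sum>k = 1..n. Q k f i) = lam * f i"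
    and m: "m > 0"
  shows "lam \<in> Lambda_fd n"
proof -
  let ?V = "module_vec TYPE(complex) m" and ?F = "free_algebra n" and ?r = "residue_class n lam"
  define ext where "ext v i = (if i < m then vec_index v i else 0)" for v :: "complex vec" and i
  \<comment> \<open>A residue class acts through any of its representatives, since all of them act alike.\<close>
  define rep where "rep X = (SOME p. p \<in> carrier ?F \<and> X = ?r p)" for X
  define \<pi> where "\<pi> X v = vec m (act Q (rep X) (ext v))" for X v
  have "act Q (rep (?r p)) = act Q p" if p: "p \<in> carrier ?F" for p
  proof
    fix f
    have "rep (?r p) \<in> carrier ?F \<and> ?r p = ?r (rep (?r p))"
      unfolding rep_def by (rule someI[of _ p]) (simp add: p)
    hence "p - rep (?r p) \<in> relation_ideal n lam" using p residue_class_eq_iff by blast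
    hence "act Q (p - rep (?r p)) f = (\<lambda>i. 0)"
      by (intro relation_ideal_acts_trivially[OF idem sum])
    thus "act Q (rep (?r p)) f = act Q p f" by (simp add: act_diff fun_eq_iff)
  qed
  hence \<pi>: "\<pi> (?r p) v = vec m (act Q p (ext v))" if "p \<in> carrier ?F" for p v
    using that by (simp add: \<pi>_def)
  have ext_add: "ext (v + w) = (\<lambda>i. ext v i + ext w i)" if "v \<in> carrier_vec m" "w \<in> carrier_vec m" for v w
    using that by (auto simp: ext_def fun_eq_iff)
  have ext_smult: "ext (c \<cdot>\<^sub>v v) = (\<lambda>i. c * ext v i)" if "v \<in> carrier_vec m" for v c
    using that by (auto simp: ext_def fun_eq_iff)
  have vec_ext: "vec m (ext v) = v" if "v \<in> carrier_vec m" for v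
    using that by (auto simp: ext_def)
  have word_support: "foldr Q ks f i = 0" if "\<And>i. i \<ge> m \<Longrightarrow> f i = 0" "i \<ge> m" for ks f i
    using that(2) by (induction ks arbitrary: i) (auto intro: that(1) support)
  have act_support: "act Q p f i = 0" if "\<And>i. i \<ge> m \<Longrightarrow> f i = 0" "i \<ge> m" for p f i
    unfolding act_def using word_support[of f, OF that] by simp
  have ext_vec: "ext (vec m (act Q p (ext v))) = act Q p (ext v)" for p v
  proof
    fix i show "ext (vec m (act Q p (ext v))) i = act Q p (ext v) i"
      using act_support[of "ext v" i p] by (auto simp: ext_def)
  qed
  have "representation (Q_algebra n lam) ?V \<pi>"
    unfolding representation_def
  proof (intro conjI ballI allI)
    fix a assume "a \<in> carrier (Q_algebra n lam)"
    then obtain p where p: "p \<in> carrier ?F" "a = ?r p" by (auto simp: carrier_Q_algebra)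
    show "\<pi> a \<in> endomorphisms ?V"
      unfolding endomorphisms_def module_hom_def module_vec_simps
      using p by (auto simp: \<pi> ext_add ext_smult linear_operator_add[OF act_linear]
          linear_operator_scale[OF act_linear])
    fix v assume v: "v \<in> carrier ?V"
    show "\<pi> (c \<odot>\<^bsub>Q_algebra n lam\<^esub> a) v = c \<odot>\<^bsub>?V\<^esub> \<pi> a v" for c
      using p by (auto simp: residue_class_simps \<pi> free_algebra_closed const_carrier act_mult act_const
          module_vec_simps)
    fix b assume "b \<in> carrier (Q_algebra n lam)"
    then obtain q where q: "q \<in> carrier ?F" "b = ?r q" by (auto simp: carrier_Q_algebra)
    show "\<pi> (a \<oplus>\<^bsub>Q_algebra n lam\<^esub> b) v = \<pi> a v \<oplus>\<^bsub>?V\<^esub> \<pi> b v"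
      using p q by (auto simp: residue_class_simps \<pi> free_algebra_closed act_add module_vec_simps)
    show "\<pi> (a \<otimes>\<^bsub>Q_algebra n lam\<^esub> b) v = \<pi> a (\<pi> b v)"
      using p q by (simp add: residue_class_simps \<pi> free_algebra_closed act_mult ext_vec)
  next
    fix v assume "v \<in> carrier ?V"
    thus "\<pi> \<one>\<^bsub>Q_algebra n lam\<^esub> v = v"
      by (simp add: residue_class_one \<pi> free_algebra_closed act_one vec_ext module_vec_simps)
  qed
  moreover have "carrier ?V \<noteq> {\<zero>\<^bsub>?V\<^esub>}"
  proof
    assume "carrier ?V = {\<zero>\<^bsub>?V\<^esub>}"
    moreover have "unit_vec m 0 \<in> carrier ?V" by (simp add: module_vec_simps)
    ultimately have "unit_vec m 0 = (0\<^sub>v m :: complex vec)" by (simp add: module_vec_simps)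
    hence "vec_index (unit_vec m 0) 0 = vec_index (0\<^sub>v m :: complex vec) 0" by (simp only:)
    thus False using m by simp
  qed
  moreover have "vectorspace class_ring ?V" by (rule vec_vs)
  moreover have "vectorspace.fin_dim class_ring ?V" by (rule vec_space.fin_dim)
  ultimately have "lam \<in> Lambda_fd_on TYPE(complex vec) n"
    unfolding Lambda_fd_on_def by (intro CollectI exI[of _ ?V] exI[of _ \<pi>] conjI)
  thus ?thesis using Lambda_fd_on_subset by blast
qed

end

section \<open>Idempotents from a terminating chain\<close>

text \<open>The inverse of \<open>(p, q) \<mapsto> (p + q - 1, p - q)\<close>: the sign \<open>c = 1\<close> recovers \<open>p\<close> and \<open>c = - 1\<close> recovers \<open>q\<close>.\<close>

definition pair_idempotent ::
  "complex \<Rightarrow> ((nat \<Rightarrow> complex) \<Rightarrow> nat \<Rightarrow> complex) \<Rightarrow> ((nat \<Rightarrow> complex) \<Rightarrow> nat \<Rightarrow> complex) \<Rightarrow>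
    (nat \<Rightarrow> complex) \<Rightarrow> nat \<Rightarrow> complex" where
  "pair_idempotent c X D f = (\<lambda>j. (f j + X f j + c * D f j) / 2)"

lemma linear_pair_idempotent:
  assumes "linear_operator X" "linear_operator D"
  shows "linear_operator (pair_idempotent c X D)"
  using assms by (simp add: linear_operator_def pair_idempotent_def fun_eq_iff field_simps)

lemma pair_idempotent_idem:
  assumes X: "linear_operator X" and D: "linear_operator D"
    and XD: "\<And>f j. X (D f) j = - D (X f) j" and DD: "\<And>f j. D (D f) j = f j - X (X f) j"
    and c: "c\<^sup>2 = 1"
  shows "pair_idempotent c X D (pair_idempotent c X D f) = pair_idempotent c X D f"
proof
  fix j
  have T: "T (pair_idempotent c X D f) j = (T f j + T (X f) j + c * T (D f) j) / 2"
    if "linear_operator T" for T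
  proof -
    have "pair_idempotent c X D f = (\<lambda>i. 1 / 2 * f i + 1 / 2 * (1 * X f i + c * D f i))"
      by (simp add: pair_idempotent_def fun_eq_iff field_simps)
    thus ?thesis
      using linear_operatorD[OF that, of "1 / 2" f "1 / 2" "\<lambda>i. 1 * X f i + c * D f i"]
        linear_operatorD[OF that, of 1 "X f" c "D f"] by (simp add: field_simps)
  qed
  have "pair_idempotent c X D (pair_idempotent c X D f) j =
      (pair_idempotent c X D f j + X (pair_idempotent c X D f) j + c * D (pair_idempotent c X D f) j) / 2"
    by (subst pair_idempotent_def) (rule refl)
  also have "\<dots> = (f j + 2 * X f j + 2 * c * D f j + X (X f) j + c\<^sup>2 * D (D f) j) / 4"
    unfolding T[OF X] T[OF D] XD by (simp add: pair_idempotent_def field_simps power2_eq_square)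
  also have "\<dots> = pair_idempotent c X D f j"
    by (simp add: c DD pair_idempotent_def field_simps)
  finally show "pair_idempotent c X D (pair_idempotent c X D f) j = pair_idempotent c X D f j" .
qed

text \<open>The successive values obtained from \<open>\<epsilon>\<close> by reflecting alternately at \<open>\<mu>\<close> and at \<open>0\<close>.\<close>

definition chain_eigenvalue :: "complex \<Rightarrow> complex \<Rightarrow> nat \<Rightarrow> complex" where
  "chain_eigenvalue \<epsilon> \<mu> j = (if even j then \<epsilon> - of_nat j * \<mu> else of_nat (j + 1) * \<mu> - \<epsilon>)"

text \<open>The chain of reflections, read as a construction: \<open>X\<close> is diagonal with the values of the chain on
  the diagonal, \<open>E\<close> joins the positions \<open>0, 1\<close>, then \<open>2, 3\<close>, and so on, and \<open>D\<close> joins \<open>1, 2\<close>, then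
  \<open>3, 4\<close>, and so on. On each joined pair the square of \<open>D\<close> or \<open>E\<close> is the required scalar. That scalar
  sits entirely in the step to the right; it vanishes at position \<open>k\<close> by the choice of \<open>\<mu>\<close>, so the
  sequences supported below \<open>k\<close> are an invariant subspace.\<close>

lemma chain_parameter_in_Lambda_fd:
  assumes k: "k \<ge> 1" and \<epsilon>: "\<epsilon>\<^sup>2 = 1" and \<mu>: "of_nat k * \<mu> = 2 * \<epsilon>"
  shows "2 + \<mu> \<in> Lambda_fd 4"
proof -
  let ?s = "chain_eigenvalue \<epsilon> \<mu>"
  define X Y where "X f j = ?s j * f j" and "Y f j = (\<mu> - ?s j) * f j" for f j
  define D where "D f j = (if odd j then f (j + 1) else if j = 0 then 0 else (1 - (?s j)\<^sup>2) * f (j - 1))" for f j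
  define E where "E f j = (if even j then f (j + 1) else (1 - (\<mu> - ?s j)\<^sup>2) * f (j - 1))" for f j
  have lin: "linear_operator X" "linear_operator Y" "linear_operator D" "linear_operator E"
    by (simp_all add: linear_operator_def X_def Y_def D_def E_def fun_eq_iff algebra_simps)
  have s_odd: "?s (Suc j) = - ?s j" if "odd j" for j
    using that by (simp add: chain_eigenvalue_def algebra_simps)
  have s_even: "?s (Suc j) = 2 * \<mu> - ?s j" if "even j" for j
    using that by (simp add: chain_eigenvalue_def algebra_simps)
  \<comment> \<open>The scalar required of \<open>D\<^sup>2\<close> at position \<open>0\<close> is zero, so \<open>D\<close> needs no partner for that position.\<close>
  have s_0: "(?s 0)\<^sup>2 = 1" using \<epsilon> by (simp add: chain_eigenvalue_def)
  have XD: "X (D f) j = - D (X f) j" for f j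
    using s_odd[of j] s_odd[of "j - 1"] by (cases j) (auto simp: X_def D_def)
  have DD: "D (D f) j = f j - X (X f) j" for f j
    using s_odd[of j] s_odd[of "j - 1"] s_0
    by (cases j) (auto simp: X_def D_def power2_eq_square algebra_simps)
  have YE: "Y (E f) j = - E (Y f) j" for f j
    by (cases j) (auto simp: Y_def E_def s_even algebra_simps)
  have EE: "E (E f) j = f j - Y (Y f) j" for f j
    by (cases j) (auto simp: Y_def E_def s_even power2_eq_square algebra_simps)
  define Q where "Q i = (if i = 1 then pair_idempotent 1 X D else if i = 2 then pair_idempotent (-1) X D
      else if i = 3 then pair_idempotent 1 Y E else pair_idempotent (-1) Y E)" for i :: nat
  have "D f j = 0 \<and> E f j = 0" if f: "\<And>j. j \<ge> k \<Longrightarrow> f j = 0" and j: "j \<ge> k" for f j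
  proof (cases "j = k")
    case True
    have "(?s k)\<^sup>2 = 1" if "even k"
      using that \<epsilon> \<mu> by (simp add: chain_eigenvalue_def)
    moreover have "(\<mu> - ?s k)\<^sup>2 = 1" if "odd k"
    proof -
      have "\<mu> - ?s k = - \<epsilon>" using that \<mu> by (simp add: chain_eigenvalue_def algebra_simps)
      thus ?thesis using \<epsilon> by simp
    qed
    ultimately show ?thesis using f True by (auto simp: D_def E_def)
  next
    case False
    thus ?thesis using f j by (auto simp: D_def E_def)
  qed
  hence support: "Q i f j = 0" if "\<And>j. j \<ge> k \<Longrightarrow> f j = 0" "j \<ge> k" for i f j
    using that by (auto simp: Q_def pair_idempotent_def X_def Y_def)
  show ?thesis
  proof (rule Lambda_fd_of_operators[of Q k])
    show "linear_operator (Q i)" for i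
      using lin by (auto simp: Q_def intro: linear_pair_idempotent)
    show "Q i f j = 0" if "\<And>j. j \<ge> k \<Longrightarrow> f j = 0" "j \<ge> k" for i f j
      by (rule support[OF that])
    show "Q i (Q i f) = Q i f" for i f
      using pair_idempotent_idem[OF lin(1,3) XD DD] pair_idempotent_idem[OF lin(2,4) YE EE]
      by (auto simp: Q_def)
    have "{1..4::nat} = {1, 2, 3, 4}" by auto
    thus "(\<Sum>i = 1..4. Q i f j) = (2 + \<mu>) * f j" for f j
      by (simp add: Q_def pair_idempotent_def X_def Y_def field_simps)
    show "k > 0" using k by simp
  qed
qed

lemma two_in_Lambda_fd: "2 \<in> Lambda_fd 4"
proof (rule Lambda_fd_of_operators[where m = 1 and Q = "\<lambda>i f. if i \<le> 2 then f else (\<lambda>j. 0)"])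
  have "{1..4::nat} = {1, 2, 3, 4}" by auto
  thus "(\<Sum>i = 1..4::nat. (if i \<le> 2 then f else (\<lambda>j. 0)) j) = 2 * f j" for f :: "nat \<Rightarrow> complex" and j
    by simp
qed (auto simp: linear_operator_def)

section \<open>The parameter set\<close>

theorem proposition4:
  "Lambda_fd 4 = Lambda_bd 4 \<and>
   Lambda_bd 4 =
     {2 + 2 / of_nat k | k :: nat. k \<ge> 1} \<union> {2 - 2 / of_nat k | k :: nat. k \<ge> 1} \<union> {2}"
proof -
  let ?S = "{2 + 2 / of_nat k | k :: nat. k \<ge> 1} \<union> {2 - 2 / of_nat k | k :: nat. k \<ge> 1} \<union> {2}
    :: complex set"
  have "Lambda_fd 4 \<subseteq> Lambda_bd 4"
    unfolding Lambda_fd_def Lambda_bd_def by (rule Lambda_fd_on_subset_bd)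
  moreover have "Lambda_bd 4 \<subseteq> ?S"
    unfolding Lambda_bd_def by (rule Lambda_bd_on_4_subset)
  moreover have "?S \<subseteq> Lambda_fd 4"
  proof -
    have "2 + 2 / of_nat k \<in> Lambda_fd 4" "2 - 2 / of_nat k \<in> Lambda_fd 4" if "k \<ge> 1" for k :: nat
      using chain_parameter_in_Lambda_fd[OF that, of 1 "2 / of_nat k"]
        chain_parameter_in_Lambda_fd[OF that, of "-1" "- (2 / of_nat k)"] that by simp_all
    thus ?thesis using two_in_Lambda_fd by auto
  qed
  ultimately show ?thesis by blast
qed

end
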